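(* Let $M$ be a complex submanifold, of real dimension $n$, of a Kähler manifold $(\tilde M,\tilde g)$, endowed with the induced metric $g$. Then $M$ is $(2k)$-minimal for every integer $k\ge 0$ with $2k\le n$.
   Context: Double forms. On an $n$-dimensional Euclidean vector space $(V,g)$, a $(p,q)$-double form is an element of $\Lambda^pV^*\otimes\Lambda^qV^*$, viewed as a bilinear form $\Lambda^pV\times\Lambda^qV\to\mathbb R$. The exterior product is $(\theta_1\otimes\theta_2)(\theta_3\otimes\theta_4)=(\theta_1\wedge\theta_3)\otimes(\theta_2\wedge\theta_4)$, so that $B^k(x_1\wedge\dots\wedge x_k,y_1\wedge\dots\wedge y_k)=k!\det[B(x_i,y_j)]$ for a symmetric bilinear form $B$. For an $(n,n)$-double form $\omega$, the generalized Hodge star is the scalar $*\omega=\omega(e_1\wedge\dots\wedge e_n,e_1\wedge\dots\wedge e_n)$ for any orthonormal basis $(e_i)$. These operations are applied pointwise on tangent spaces. $(2k)$-minimality. Let $(M,g)$ be an $n$-dimensional submanifold of $(\tilde M,\tilde g)$ with induced metric, $R$ its Riemann curvature tensor viewed as a symmetric $(2,2)$-double form with sign such that $R(x\wedge y,x\wedge y)$ is the sectional curvature for orthonormal $x,y$, and $B$ its vector-valued second fundamental form; for a normal vector $N$ put $B_N(u,v)=\tilde g(B(u,v),N)$. For $n\ge 2k+1$ the $(2k+1)$-Gauss-Bonnet curvature is $h_{2k+1}(N)=*\left(\frac{g^{n-2k-1}}{(n-2k-1)!}R^kB_N\right)$; for $n=2k$, $h_{2k+1}(N)=0$. $M$ is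 called $(2k)$-minimal if $h_{2k+1}(N)=0$ for all normal vectors $N$ at all points of $M$. *)

theory Defs
  imports "HOL-Analysis.Analysis"
begin

section \<open>Smooth and holomorphic maps between vector spaces\<close>

abbreviation D :: "('a::real_normed_vector \<Rightarrow> 'b::real_normed_vector) \<Rightarrow> 'a \<Rightarrow> 'a \<Rightarrow> 'b"
  where "D F x \<equiv> frechet_derivative F (at x)"

text \<open>Only used on open sets.\<close>
primrec Ck_on :: "nat \<Rightarrow> 'a set \<Rightarrow> ('a::real_normed_vector \<Rightarrow> 'b::real_normed_vector) \<Rightarrow> bool" where
  "Ck_on 0 S F \<longleftrightarrow> continuous_on S F"
| "Ck_on (Suc k) S F \<longleftrightarrow>
     (\<forall>x\<in>S. F differentiable (at x)) \<and> (\<forall>v. Ck_on k S (\<lambda>x. D F x v))"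

definition smooth_on :: "'a set \<Rightarrow> ('a::real_normed_vector \<Rightarrow> 'b::real_normed_vector) \<Rightarrow> bool"
  where "smooth_on S F \<longleftrightarrow> (\<forall>k. Ck_on k S F)"

definition J :: "complex ^ 'n \<Rightarrow> complex ^ 'n"
  where "J v = \<i> *s v"

definition holomorphic_map_on :: "(complex ^ 'n) set \<Rightarrow> (complex ^ 'n \<Rightarrow> complex ^ 'm) \<Rightarrow> bool"
  where "holomorphic_map_on S F \<longleftrightarrow>
    smooth_on S F \<and> (\<forall>x\<in>S. \<forall>v. D F x (J v) = J (D F x v))"


section \<open>Manifolds\<close>

text \<open>A chart is a pair of a domain and a coordinate map. Tangent vectors and tensors at a
  point are given by their components with respect to the charts around it.\<close>

type_synonym ('p, 'a) chart = "'p set \<times> ('p \<Rightarrow> 'a)"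

definition local_rep :: "('p, 'a) chart \<Rightarrow> ('q, 'b) chart \<Rightarrow> ('p \<Rightarrow> 'q) \<Rightarrow> 'a \<Rightarrow> 'b"
  where "local_rep c d f = snd d \<circ> f \<circ> inv_into (fst c) (snd c)"

definition local_dom :: "('p, 'a) chart \<Rightarrow> ('q, 'b) chart \<Rightarrow> ('p \<Rightarrow> 'q) \<Rightarrow> 'a set"
  where "local_dom c d f = snd c ` (fst c \<inter> f -` fst d)"

locale smooth_manifold =
  fixes X :: "'p topology" and A :: "('p, 'a::euclidean_space) chart set"
  assumes Hausdorff: "Hausdorff_space X"
    and second_countable: "second_countable X"
    and cover: "(\<Union>c\<in>A. fst c) = topspace X"
    and chart_dom: "c \<in> A \<Longrightarrow> openin X (fst c)"
    and chart_range: "c \<in> A \<Longrightarrow> open (snd c ` fst c)"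
    and chart_homeo: "c \<in> A \<Longrightarrow>
      homeomorphic_map (subtopology X (fst c)) (top_of_set (snd c ` fst c)) (snd c)"
    and transition_smooth: "c \<in> A \<Longrightarrow> d \<in> A \<Longrightarrow>
      smooth_on (local_dom c d (\<lambda>p. p)) (local_rep c d (\<lambda>p. p))"

locale complex_manifold = smooth_manifold X A
  for X :: "'p topology" and A :: "('p, complex ^ 'n) chart set" +
  assumes transition_holomorphic: "c \<in> A \<Longrightarrow> d \<in> A \<Longrightarrow>
    holomorphic_map_on (local_dom c d (\<lambda>p. p)) (local_rep c d (\<lambda>p. p))"

text \<open>\<open>g c x u v\<close> is the value of the metric at the point with coordinates \<open>x\<close> in the chart \<open>c\<close>,
  on the tangent vectors with components \<open>u\<close> and \<open>v\<close> in that chart.\<close>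

locale riemannian_manifold = smooth_manifold X A
  for X :: "'p topology" and A :: "('p, 'a::euclidean_space) chart set" +
  fixes g :: "('p, 'a) chart \<Rightarrow> 'a \<Rightarrow> 'a \<Rightarrow> 'a \<Rightarrow> real"
  assumes metric_bilinear: "c \<in> A \<Longrightarrow> x \<in> snd c ` fst c \<Longrightarrow> bilinear (g c x)"
    and metric_sym: "c \<in> A \<Longrightarrow> x \<in> snd c ` fst c \<Longrightarrow> g c x u v = g c x v u"
    and metric_pos: "c \<in> A \<Longrightarrow> x \<in> snd c ` fst c \<Longrightarrow> u \<noteq> 0 \<Longrightarrow> g c x u u > 0"
    and metric_smooth: "c \<in> A \<Longrightarrow> smooth_on (snd c ` fst c) (\<lambda>x. g c x u v)"
    and metric_transform: "c \<in> A \<Longrightarrow> d \<in> A \<Longrightarrow> x \<in> local_dom c d (\<lambda>p. p) \<Longrightarrow>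
      F = local_rep c d (\<lambda>p. p) \<Longrightarrow> g c x u v = g d (F x) (D F x u) (D F x v)"

text \<open>Exterior derivative of a 2-form on an open subset of a vector space, evaluated on
  constant vector fields.\<close>
definition ext_deriv2 :: "('a::real_normed_vector \<Rightarrow> 'a \<Rightarrow> 'a \<Rightarrow> real) \<Rightarrow> 'a \<Rightarrow> 'a \<Rightarrow> 'a \<Rightarrow> 'a \<Rightarrow> real"
  where "ext_deriv2 \<omega> x u v w =
    D (\<lambda>y. \<omega> y v w) x u + D (\<lambda>y. \<omega> y w u) x v + D (\<lambda>y. \<omega> y u v) x w"

locale kaehler_manifold = complex_manifold X A + riemannian_manifold X A h
  for X :: "'p topology" and A :: "('p, complex ^ 'n) chart set"
    and h :: "('p, complex ^ 'n) chart \<Rightarrow> complex ^ 'n \<Rightarrow> complex ^ 'n \<Rightarrow> complex ^ 'n \<Rightarrow> real" +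
  assumes hermitian: "c \<in> A \<Longrightarrow> x \<in> snd c ` fst c \<Longrightarrow> h c x (J u) (J v) = h c x u v"
    and kaehler_form_closed: "c \<in> A \<Longrightarrow> x \<in> snd c ` fst c \<Longrightarrow>
      ext_deriv2 (\<lambda>y u v. h c y (J u) v) x u v w = 0"

text \<open>Submanifolds are immersed: \<open>f\<close> is the inclusion of the submanifold, and \<open>g\<close> its
  induced metric.\<close>

locale isometric_immersion =
  sub: riemannian_manifold X A g + ambient: riemannian_manifold Y B h
  for X :: "'p topology" and A :: "('p, 'a::euclidean_space) chart set" and g
    and Y :: "'q topology" and B :: "('q, 'b::euclidean_space) chart set" and h +
  fixes f :: "'p \<Rightarrow> 'q"
  assumes map_continuous: "continuous_map X Y f"
    and map_smooth: "c \<in> A \<Longrightarrow> d \<in> B \<Longrightarrow> smooth_on (local_dom c d f) (local_rep c d f)"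
    and immersion: "c \<in> A \<Longrightarrow> d \<in> B \<Longrightarrow> x \<in> local_dom c d f \<Longrightarrow> inj (D (local_rep c d f) x)"
    and induced_metric: "c \<in> A \<Longrightarrow> d \<in> B \<Longrightarrow> x \<in> local_dom c d f \<Longrightarrow> F = local_rep c d f \<Longrightarrow>
      g c x u v = h d (F x) (D F x u) (D F x v)"

locale complex_submanifold =
  isometric_immersion X A g Y B h f + complex_sub: complex_manifold X A
    + complex_ambient: complex_manifold Y B
  for X :: "'p topology" and A :: "('p, complex ^ 'n) chart set" and g
    and Y :: "'q topology" and B :: "('q, complex ^ 'm) chart set" and h and f +
  assumes map_holomorphic: "c \<in> A \<Longrightarrow> d \<in> B \<Longrightarrow>
    holomorphic_map_on (local_dom c d f) (local_rep c d f)"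


section \<open>Levi-Civita connection, curvature and second fundamental form in charts\<close>

text \<open>\<open>christoffel g x u v\<close> is the Levi-Civita derivative of the constant vector field \<open>v\<close> in
  the direction \<open>u\<close>, given by the Koszul formula.\<close>
definition christoffel ::
    "('a::euclidean_space \<Rightarrow> 'a \<Rightarrow> 'a \<Rightarrow> real) \<Rightarrow> 'a \<Rightarrow> 'a \<Rightarrow> 'a \<Rightarrow> 'a"
  where "christoffel g x u v = (THE w. \<forall>z. 2 * g x w z =
    D (\<lambda>y. g y v z) x u + D (\<lambda>y. g y u z) x v - D (\<lambda>y. g y u v) x z)"

text \<open>Covariant derivative of the vector field \<open>Z\<close> in the direction \<open>u\<close>.\<close>
definition cov_deriv ::
    "('a::euclidean_space \<Rightarrow> 'a \<Rightarrow> 'a \<Rightarrow> real) \<Rightarrow> ('a \<Rightarrow> 'a) \<Rightarrow> 'a \<Rightarrow> 'a \<Rightarrow> 'a"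
  where "cov_deriv g Z x u = D Z x u + christoffel g x u (Z x)"

text \<open>The bracket term of the curvature vanishes, since \<open>u\<close> and \<open>v\<close> are extended as
  constant vector fields.\<close>
definition curvature ::
    "('a::euclidean_space \<Rightarrow> 'a \<Rightarrow> 'a \<Rightarrow> real) \<Rightarrow> 'a \<Rightarrow> 'a \<Rightarrow> 'a \<Rightarrow> 'a \<Rightarrow> 'a"
  where "curvature g x u v w =
    cov_deriv g (\<lambda>y. cov_deriv g (\<lambda>_. w) y v) x u - cov_deriv g (\<lambda>y. cov_deriv g (\<lambda>_. w) y u) x v"

text \<open>The second fundamental form of a map \<open>F\<close> between open subsets of vector spaces, the target
  with metric \<open>h\<close>: the normal component of the ambient derivative of the field \<open>D F y v\<close> along
  \<open>F\<close>.\<close>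

definition normal_vector ::
    "('b \<Rightarrow> 'b \<Rightarrow> 'b \<Rightarrow> real) \<Rightarrow> ('a::euclidean_space \<Rightarrow> 'b::euclidean_space) \<Rightarrow> 'a \<Rightarrow> 'b \<Rightarrow> bool"
  where "normal_vector h F x N \<longleftrightarrow> (\<forall>u. h (F x) (D F x u) N = 0)"

definition normal_part ::
    "('b \<Rightarrow> 'b \<Rightarrow> 'b \<Rightarrow> real) \<Rightarrow> ('a::euclidean_space \<Rightarrow> 'b::euclidean_space) \<Rightarrow> 'a \<Rightarrow> 'b \<Rightarrow> 'b"
  where "normal_part h F x w = (THE N. normal_vector h F x N \<and> w - N \<in> range (D F x))"

definition second_fundamental_form ::
    "('b \<Rightarrow> 'b \<Rightarrow> 'b \<Rightarrow> real) \<Rightarrow> ('a::euclidean_space \<Rightarrow> 'b::euclidean_space) \<Rightarrow> 'a \<Rightarrow> 'a \<Rightarrow> 'a \<Rightarrow> 'b"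
  where "second_fundamental_form h F x u v =
    normal_part h F x (D (\<lambda>y. D F y v) x u + christoffel h (F x) (D F x u) (D F x v))"


section \<open>Double forms\<close>

text \<open>A \<open>(p,q)\<close>-double form \<open>\<omega>\<close> is represented by
  \<open>\<omega> x y = \<omega>(x 0 \<and> \<dots> \<and> x (p - 1), y 0 \<and> \<dots> \<and> y (q - 1))\<close>;
  the other entries of the sequences \<open>x\<close>, \<open>y\<close> are ignored.\<close>

type_synonym 'v dform = "(nat \<Rightarrow> 'v) \<Rightarrow> (nat \<Rightarrow> 'v) \<Rightarrow> real"

text \<open>Exterior product of a \<open>(p,q)\<close>-double form and an \<open>(r,s)\<close>-double form, with the
  normalization of the wedge product for which
  \<open>(\<theta>\<^sub>1 \<and> \<theta>\<^sub>2)(u,v) = \<theta>\<^sub>1 u * \<theta>\<^sub>2 v - \<theta>\<^sub>1 v * \<theta>\<^sub>2 u\<close> for covectors, so that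
  the \<open>k\<close>-th power of a symmetric bilinear form \<open>B\<close> is \<open>k! det [B(x i, y j)]\<close>.\<close>
definition dprod :: "nat \<Rightarrow> nat \<Rightarrow> nat \<Rightarrow> nat \<Rightarrow> 'v dform \<Rightarrow> 'v dform \<Rightarrow> 'v dform"
  where "dprod p q r s \<alpha> \<beta> x y =
    (\<Sum>\<sigma> | \<sigma> permutes {..<p + r}. \<Sum>\<tau> | \<tau> permutes {..<q + s}.
       of_int (sign \<sigma> * sign \<tau>) * \<alpha> (\<lambda>i. x (\<sigma> i)) (\<lambda>i. y (\<tau> i))
         * \<beta> (\<lambda>i. x (\<sigma> (p + i))) (\<lambda>i. y (\<tau> (q + i))))
    / (fact p * fact q * fact r * fact s)"

text \<open>\<open>k\<close>-th exterior power of a \<open>(p,q)\<close>-double form.\<close>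
primrec dpower :: "nat \<Rightarrow> nat \<Rightarrow> 'v dform \<Rightarrow> nat \<Rightarrow> 'v dform" where
  "dpower p q \<alpha> 0 = (\<lambda>x y. 1)"
| "dpower p q \<alpha> (Suc k) = dprod (k * p) (k * q) p q (dpower p q \<alpha> k) \<alpha>"

definition bilinear_dform :: "('v \<Rightarrow> 'v \<Rightarrow> real) \<Rightarrow> 'v dform"
  where "bilinear_dform b x y = b (x 0) (y 0)"

text \<open>Orthonormal with respect to the scalar product \<open>b\<close>.\<close>
definition orthonormal_basis :: "('v::euclidean_space \<Rightarrow> 'v \<Rightarrow> real) \<Rightarrow> (nat \<Rightarrow> 'v) \<Rightarrow> bool"
  where "orthonormal_basis b e \<longleftrightarrow>
    (\<forall>i < DIM('v). \<forall>j < DIM('v). b (e i) (e j) = (if i = j then 1 else 0))"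

definition hodge_star :: "('v::euclidean_space \<Rightarrow> 'v \<Rightarrow> real) \<Rightarrow> 'v dform \<Rightarrow> real"
  where "hodge_star b \<omega> = (THE r. \<forall>e. orthonormal_basis b e \<longrightarrow> \<omega> e e = r)"

definition curvature_dform :: "('a::euclidean_space \<Rightarrow> 'a \<Rightarrow> 'a \<Rightarrow> real) \<Rightarrow> 'a \<Rightarrow> 'a dform"
  where "curvature_dform g x u w = g x (curvature g x (u 0) (u 1) (w 1)) (w 0)"


section \<open>Gauss-Bonnet curvatures of odd order and minimality\<close>

text \<open>\<open>h\<^bsub>2k+1\<^esub>\<close> in terms of the scalar product \<open>b\<close>, the curvature double form \<open>R\<close> and the
  second fundamental form \<open>b\<^sub>N\<close> of a normal vector on a tangent space.\<close>
definition gauss_bonnet_odd ::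
    "nat \<Rightarrow> ('v::euclidean_space \<Rightarrow> 'v \<Rightarrow> real) \<Rightarrow> 'v dform \<Rightarrow> ('v \<Rightarrow> 'v \<Rightarrow> real) \<Rightarrow> real"
  where "gauss_bonnet_odd k b R b\<^sub>N =
    (let n = DIM('v); m = n - 2 * k - 1 in
     if 2 * k + 1 \<le> n then
       hodge_star b
         (dprod m m (2 * k + 1) (2 * k + 1)
           (\<lambda>x y. dpower 1 1 (bilinear_dform b) m x y / fact m)
           (dprod (2 * k) (2 * k) 1 1 (dpower 2 2 R k) (bilinear_dform b\<^sub>N)))
     else 0)"

definition (in isometric_immersion) minimal_2k :: "nat \<Rightarrow> bool"
  where "minimal_2k k \<longleftrightarrow>
    (\<forall>c\<in>A. \<forall>d\<in>B. \<forall>x\<in>local_dom c d f. \<forall>N. normal_vector (h d) (local_rep c d f) x N \<longrightarrow>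
       gauss_bonnet_odd k (g c x) (curvature_dform (g c) x)
         (\<lambda>u v. h d (local_rep c d f x)
            (second_fundamental_form (h d) (local_rep c d f) x u v) N) = 0)"

end

(* Extending \<open>J\<close> to all vector arguments preserves the metric and the curvature double form of a
   complex submanifold of a Kaehler manifold (its connection commutes with \<open>J\<close>), but changes the
   sign of every \<open>B_N\<close>, since \<open>B\<close> is complex bilinear. So \<open>J\<close> changes the sign of the top double
   form \<open>g^(n-2k-1) R^k B_N\<close>. On the other hand, a linear map acts on top double forms by the
   square of its determinant, which is not \<open>-1\<close>. Hence this form vanishes. *)

theory Submission
  imports Defs
begin

section \<open>Multilinear double forms\<close>

text \<open>The sign survives because \<open>B_N\<close> occurs exactly once in the product, next to
  any number of invariant factors \<open>g\<close> and \<open>R\<close>. For the ambient metric,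
  \<nabla>J = 0 follows from closedness of the Kaehler form by comparing Koszul formulas. The
  submanifold inherits it through the Gauss formula: its connection is the tangential part of the
  ambient one, and holomorphy makes tangent spaces stable under \<open>J\<close>. This yields
  invariance of \<open>R\<close> in one pair of arguments; the other pair is reached by the pair
  symmetry of the curvature, whence the classical curvature identities. The main obstacle is that
  \<open>christoffel\<close>, \<open>normal_part\<close> and \<open>hodge_star\<close> are definite
  descriptions. Each needs a unique solution, and \<open>christoffel\<close> must also be
  differentiable in the point before its derivatives in \<open>curvature\<close> mean anything.
  Orthonormal frames that vary differentiably serve this purpose. For \<open>hodge_star\<close>, the
  determinant argument is applied to every orthonormal basis, so all of them give the same value
  0.\<close>

definition multilinear_form :: "nat \<Rightarrow> ((nat \<Rightarrow> 'v::real_vector) \<Rightarrow> real) \<Rightarrow> bool" where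
  "multilinear_form n \<phi> \<longleftrightarrow>
    (\<forall>x y. (\<forall>i<n. x i = y i) \<longrightarrow> \<phi> x = \<phi> y) \<and> (\<forall>x. \<forall>i<n. linear (\<lambda>v. \<phi> (x(i := v))))"

definition alternating :: "nat \<Rightarrow> ((nat \<Rightarrow> 'v) \<Rightarrow> real) \<Rightarrow> bool" where
  "alternating n \<phi> \<longleftrightarrow> (\<forall>x \<pi>. \<pi> permutes {..<n} \<longrightarrow> \<phi> (x \<circ> \<pi>) = of_int (sign \<pi>) * \<phi> x)"

definition multilinear_dform :: "nat \<Rightarrow> nat \<Rightarrow> 'v::real_vector dform \<Rightarrow> bool" where
  "multilinear_dform p q \<omega> \<longleftrightarrow>
    (\<forall>y. multilinear_form p (\<lambda>x. \<omega> x y)) \<and> (\<forall>x. multilinear_form q (\<omega> x))"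

section \<open>Closure properties of multilinear forms\<close>

lemma multilinear_form_local:
  "multilinear_form n \<phi> \<Longrightarrow> (\<And>i. i < n \<Longrightarrow> x i = y i) \<Longrightarrow> \<phi> x = \<phi> y"
  unfolding multilinear_form_def by metis

lemma multilinear_form_linear:
  "multilinear_form n \<phi> \<Longrightarrow> i < n \<Longrightarrow> linear (\<lambda>v. \<phi> (x(i := v)))"
  unfolding multilinear_form_def by metis

lemma multilinear_form_sum:
  assumes "\<And>a. a \<in> S \<Longrightarrow> multilinear_form n (\<phi> a)"
  shows "multilinear_form n (\<lambda>x. \<Sum>a\<in>S. \<phi> a x)"
  unfolding multilinear_form_def
proof safe
  fix x y :: "nat \<Rightarrow> 'b" assume "\<forall>i<n. x i = y i"
  then show "(\<Sum>a\<in>S. \<phi> a x) = (\<Sum>a\<in>S. \<phi> a y)"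
    by (intro sum.cong refl multilinear_form_local[OF assms]) auto
next
  fix x :: "nat \<Rightarrow> 'b" and i assume "i < n"
  then show "linear (\<lambda>v. \<Sum>a\<in>S. \<phi> a (x(i := v)))"
    by (intro linear_compose_sum ballI multilinear_form_linear[OF assms])
qed

lemma multilinear_form_cmult:
  assumes "multilinear_form n \<phi>"
  shows "multilinear_form n (\<lambda>x. c * \<phi> x)"
  unfolding multilinear_form_def
proof safe
  fix x y :: "nat \<Rightarrow> 'a" assume "\<forall>i<n. x i = y i"
  then show "c * \<phi> x = c * \<phi> y"
    by (metis multilinear_form_local[OF assms])
next
  fix x :: "nat \<Rightarrow> 'a" and i assume "i < n"
  then have "linear (\<lambda>v. \<phi> (x(i := v)))" by (rule multilinear_form_linear[OF assms])
  from linear_compose_scale_right[OF this, of c]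
  show "linear (\<lambda>v. c * \<phi> (x(i := v)))" by simp
qed

text \<open>As \<open>\<sigma>\<close> is a permutation, the entry \<open>x k\<close> is read at a
  single position, the preimage of \<open>k\<close>. It therefore enters exactly one of the two
  factors, and the other factor is a constant.\<close>

lemma multilinear_form_mult_permute:
  assumes \<phi>: "multilinear_form p \<phi>" and \<psi>: "multilinear_form r \<psi>" and \<sigma>: "\<sigma> permutes {..<p + r}"
  shows "multilinear_form (p + r) (\<lambda>x. \<phi> (\<lambda>i. x (\<sigma> i)) * \<psi> (\<lambda>i. x (\<sigma> (p + i))))"
  unfolding multilinear_form_def
proof safe
  have lt: "\<sigma> i < p + r" if "i < p + r" for i
    using permutes_in_image[OF \<sigma>] that by auto
  fix x y :: "nat \<Rightarrow> 'a" assume eq: "\<forall>i<p + r. x i = y i"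
  have "\<phi> (\<lambda>i. x (\<sigma> i)) = \<phi> (\<lambda>i. y (\<sigma> i))"
    by (rule multilinear_form_local[OF \<phi>]) (use eq lt in auto)
  moreover have "\<psi> (\<lambda>i. x (\<sigma> (p + i))) = \<psi> (\<lambda>i. y (\<sigma> (p + i)))"
    by (rule multilinear_form_local[OF \<psi>]) (use eq lt in auto)
  ultimately show "\<phi> (\<lambda>i. x (\<sigma> i)) * \<psi> (\<lambda>i. x (\<sigma> (p + i))) = \<phi> (\<lambda>i. y (\<sigma> i)) * \<psi> (\<lambda>i. y (\<sigma> (p + i)))"
    by simp
next
  have inj: "\<sigma> i = \<sigma> j \<longleftrightarrow> i = j" for i j
    using permutes_inj[OF \<sigma>] by (auto dest: injD)
  fix x :: "nat \<Rightarrow> 'a" and k assume "k < p + r"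
  then obtain j where j: "k = \<sigma> j" "j < p + r"
    using permutes_image[OF \<sigma>] by (metis imageE lessThan_iff)
  show "linear (\<lambda>v. \<phi> (\<lambda>i. (x(k := v)) (\<sigma> i)) * \<psi> (\<lambda>i. (x(k := v)) (\<sigma> (p + i))))"
  proof (cases "j < p")
    case True
    have 1: "(\<lambda>i. (x(k := v)) (\<sigma> i)) = (\<lambda>i. x (\<sigma> i))(j := v)" for v
      using inj j by auto
    have 2: "(\<lambda>i. (x(k := v)) (\<sigma> (p + i))) = (\<lambda>i. x (\<sigma> (p + i)))" for v
      using inj j True by auto
    have "linear (\<lambda>v. \<phi> ((\<lambda>i. x (\<sigma> i))(j := v)))"
      by (rule multilinear_form_linear[OF \<phi> True])
    from linear_compose_scale_right[OF this, of "\<psi> (\<lambda>i. x (\<sigma> (p + i)))"]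
    show ?thesis unfolding 1 2 by (simp add: mult.commute)
  next
    case False
    then obtain l where l: "j = p + l" "l < r" using j by (metis add_less_cancel_left le_Suc_ex not_less)
    have 1: "(\<lambda>i. (x(k := v)) (\<sigma> (p + i))) = (\<lambda>i. x (\<sigma> (p + i)))(l := v)" for v
      using inj j l by auto
    have 2: "\<phi> (\<lambda>i. (x(k := v)) (\<sigma> i)) = \<phi> (\<lambda>i. x (\<sigma> i))" for v
      by (rule multilinear_form_local[OF \<phi>]) (use inj j False in auto)
    have "linear (\<lambda>v. \<psi> ((\<lambda>i. x (\<sigma> (p + i)))(l := v)))"
      by (rule multilinear_form_linear[OF \<psi> l(2)])
    from linear_compose_scale_right[OF this, of "\<phi> (\<lambda>i. x (\<sigma> i))"]
    show ?thesis unfolding 1 2 by simp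
  qed
qed

text \<open>Exchanging the two groups of arguments transfers every property of a product in the
  first group to the second.\<close>

lemma dprod_flip:
  "dprod p q r s \<alpha> \<beta> x y = dprod q p s r (\<lambda>x y. \<alpha> y x) (\<lambda>x y. \<beta> y x) y x"
  unfolding dprod_def
  by (subst sum.swap) (simp add: mult_ac)

lemma dprod_multilinear_left:
  assumes "\<And>y. multilinear_form p (\<lambda>x. \<alpha> x y)" "\<And>y. multilinear_form r (\<lambda>x. \<beta> x y)"
  shows "multilinear_form (p + r) (\<lambda>x. dprod p q r s \<alpha> \<beta> x y)"
proof -
  have "multilinear_form (p + r) (\<lambda>x. (1 / (fact p * fact q * fact r * fact s)) *
      (\<Sum>\<sigma> | \<sigma> permutes {..<p + r}. \<Sum>\<tau> | \<tau> permutes {..<q + s}.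
        of_int (sign \<sigma> * sign \<tau>) * (\<alpha> (\<lambda>i. x (\<sigma> i)) (\<lambda>i. y (\<tau> i))
         * \<beta> (\<lambda>i. x (\<sigma> (p + i))) (\<lambda>i. y (\<tau> (q + i))))))"
    by (intro multilinear_form_cmult multilinear_form_sum)
       (auto intro!: multilinear_form_mult_permute
         [where \<phi> = "\<lambda>x. \<alpha> x (\<lambda>i. y (_ i))" and \<psi> = "\<lambda>x. \<beta> x (\<lambda>i. y (_ (q + i)))"] assms)
  then show ?thesis unfolding dprod_def by (simp add: mult.assoc)
qed

lemma dprod_multilinear:
  assumes "multilinear_dform p q \<alpha>" "multilinear_dform r s \<beta>"
  shows "multilinear_dform (p + r) (q + s) (dprod p q r s \<alpha> \<beta>)"
  unfolding multilinear_dform_def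
proof safe
  show "multilinear_form (p + r) (\<lambda>x. dprod p q r s \<alpha> \<beta> x y)" for y
    using assms by (intro dprod_multilinear_left) (auto simp: multilinear_dform_def)
  show "multilinear_form (q + s) (dprod p q r s \<alpha> \<beta> x)" for x
    unfolding dprod_flip[of p q r s, abs_def]
    using assms by (intro dprod_multilinear_left) (auto simp: multilinear_dform_def)
qed

lemma multilinear_dform_divide:
  assumes "multilinear_dform p q \<alpha>"
  shows "multilinear_dform p q (\<lambda>x y. \<alpha> x y / c)"
  using assms multilinear_form_cmult[of _ _ "inverse c"]
  unfolding multilinear_dform_def divide_inverse mult.commute[of _ "inverse c"] by blast

lemma dpower_multilinear:
  assumes "multilinear_dform p q \<alpha>"
  shows "multilinear_dform (k * p) (k * q) (dpower p q \<alpha> k)"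
proof (induction k)
  case 0
  show ?case by (simp add: multilinear_dform_def multilinear_form_def)
next
  case (Suc k)
  from dprod_multilinear[OF this assms] show ?case by (simp add: add.commute)
qed

lemma bilinear_dform_multilinear:
  assumes "bilinear b"
  shows "multilinear_dform 1 1 (bilinear_dform b)"
  using assms unfolding multilinear_dform_def multilinear_form_def bilinear_dform_def bilinear_def
  by auto

text \<open>The sum over all permutations antisymmetrizes by itself: the substitution of
  \<open>\<pi> \<circ> \<sigma>\<close> for \<open>\<sigma>\<close> extracts the sign of
  \<open>\<pi>\<close>.\<close>

lemma dprod_alternating_left:
  "alternating (p + r) (\<lambda>x. dprod p q r s \<alpha> \<beta> x y)"
  unfolding alternating_def
proof safe
  fix x :: "nat \<Rightarrow> 'a" and \<pi> assume \<pi>: "\<pi> permutes {..<p + r}"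
  let ?f = "\<lambda>x \<sigma>. \<Sum>\<tau> | \<tau> permutes {..<q + s}.
       of_int (sign \<sigma> * sign \<tau>) * \<alpha> (\<lambda>i. x (\<sigma> i)) (\<lambda>i. y (\<tau> i))
         * \<beta> (\<lambda>i. x (\<sigma> (p + i))) (\<lambda>i. y (\<tau> (q + i)))"
  have "(\<Sum>\<sigma> | \<sigma> permutes {..<p + r}. ?f x \<sigma>) = (\<Sum>\<sigma> | \<sigma> permutes {..<p + r}. ?f x (\<pi> \<circ> \<sigma>))"
    by (rule setum_permutations_compose_left[OF \<pi>])
  also have "\<dots> = (\<Sum>\<sigma> | \<sigma> permutes {..<p + r}. of_int (sign \<pi>) * ?f (x \<circ> \<pi>) \<sigma>)"
  proof (intro sum.cong refl, clarify)
    fix \<sigma> assume "\<sigma> permutes {..<p + r}"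
    then have "sign (\<pi> \<circ> \<sigma>) = sign \<pi> * sign \<sigma>"
      using \<pi> by (metis finite_lessThan permutation_permutes sign_compose)
    then show "?f x (\<pi> \<circ> \<sigma>) = of_int (sign \<pi>) * ?f (x \<circ> \<pi>) \<sigma>"
      by (simp add: sum_distrib_left mult_ac)
  qed
  also have "\<dots> = of_int (sign \<pi>) * (\<Sum>\<sigma> | \<sigma> permutes {..<p + r}. ?f (x \<circ> \<pi>) \<sigma>)"
    by (simp add: sum_distrib_left)
  finally have "dprod p q r s \<alpha> \<beta> x y = of_int (sign \<pi>) * dprod p q r s \<alpha> \<beta> (x \<circ> \<pi>) y"
    by (simp add: dprod_def)
  then show "dprod p q r s \<alpha> \<beta> (x \<circ> \<pi>) y = of_int (sign \<pi>) * dprod p q r s \<alpha> \<beta> x y"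
    by (simp add: sign_def split: if_splits)
qed

lemma dprod_alternating_right:
  "alternating (q + s) (dprod p q r s \<alpha> \<beta> x)"
  unfolding dprod_flip[of p q r s, abs_def] by (rule dprod_alternating_left)

text \<open>Expands the first \<open>k\<close> arguments one at a time while the others are parked
  in \<open>z\<close>, which varies in the induction since \<open>x k\<close> sits there before it
  is expanded. Index functions are the identity beyond \<open>k\<close>, so each choice of indices
  is represented once and, for \<open>k = n\<close>, permutations of \<open>{..<n}\<close> are among
  them.\<close>

lemma multilinear_form_expand:
  fixes e :: "nat \<Rightarrow> 'v::real_vector"
  assumes \<phi>: "multilinear_form n \<phi>" and k: "k \<le> n"
    and x: "\<And>j. j < k \<Longrightarrow> x j = (\<Sum>i<n. a i j *\<^sub>R e i)"
  shows "\<phi> (\<lambda>j. if j < k then x j else z j) =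
    (\<Sum>f | (\<forall>i<k. f i < n) \<and> (\<forall>i\<ge>k. f i = i).
      (\<Prod>j<k. a (f j) j) * \<phi> (\<lambda>j. if j < k then e (f j) else z j))"
  using k x
proof (induction k arbitrary: z)
  case 0
  have "{f::nat\<Rightarrow>nat. \<forall>i. f i = i} = {\<lambda>i. i}" by auto
  then show ?case by simp
next
  case (Suc k)
  let ?F = "\<lambda>k. {f. (\<forall>i<k. f i < n) \<and> (\<forall>i\<ge>k. f i = i)}"
  let ?y = "\<lambda>f j. if j < k then e (f j) else z j"
  have eq: "(\<lambda>j. if j < Suc k then x j else z j) = (\<lambda>j. if j < k then x j else (z(k := x k)) j)"
    by (auto simp: less_Suc_eq)
  have "\<phi> (\<lambda>j. if j < Suc k then x j else z j) =
      (\<Sum>f\<in>?F k. (\<Prod>j<k. a (f j) j) * \<phi> (\<lambda>j. if j < k then e (f j) else (z(k := x k)) j))"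
    unfolding eq using Suc by simp
  also have "\<dots> = (\<Sum>f\<in>?F k. \<Sum>i<n. (\<Prod>j<k. a (f j) j) * (a i k * \<phi> ((?y f)(k := e i))))"
  proof (rule sum.cong[OF refl])
    fix f
    have "\<phi> (\<lambda>j. if j < k then e (f j) else (z(k := x k)) j) = \<phi> ((?y f)(k := x k))"
      by (rule arg_cong[where f = \<phi>]) auto
    also have "\<dots> = \<phi> ((?y f)(k := (\<Sum>i<n. a i k *\<^sub>R e i)))"
      using Suc.prems by simp
    also have "\<dots> = (\<Sum>i<n. a i k *\<^sub>R \<phi> ((?y f)(k := e i)))"
    proof -
      have "linear (\<lambda>v. \<phi> ((?y f)(k := v)))"
        using Suc.prems by (intro multilinear_form_linear[OF \<phi>]) simp
      from linear_sum[OF this, of "\<lambda>i. a i k *\<^sub>R e i"] linear_cmul[OF this]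
      show ?thesis by simp
    qed
    finally show "(\<Prod>j<k. a (f j) j) * \<phi> (\<lambda>j. if j < k then e (f j) else (z(k := x k)) j) =
        (\<Sum>i<n. (\<Prod>j<k. a (f j) j) * (a i k * \<phi> ((?y f)(k := e i))))"
      by (simp add: sum_distrib_left)
  qed
  also have "\<dots> = (\<Sum>(f, i)\<in>?F k \<times> {..<n}. (\<Prod>j<k. a (f j) j) * (a i k * \<phi> ((?y f)(k := e i))))"
    by (rule sum.cartesian_product)
  also have "\<dots> = (\<Sum>f\<in>?F (Suc k).
      (\<Prod>j<Suc k. a (f j) j) * \<phi> (\<lambda>j. if j < Suc k then e (f j) else z j))"
  \<comment> \<open>An index function for \<open>Suc k\<close> is the same as one for
    \<open>k\<close> together with its value at \<open>k\<close>; resetting that value to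
    \<open>k\<close> recovers the former.\<close>
  proof (rule sum.reindex_bij_witness[where j = "\<lambda>(f, i). f(k := i)" and i = "\<lambda>f. (f(k := k), f k)"])
    fix fi assume "fi \<in> ?F k \<times> {..<n}"
    then obtain f i where fi: "fi = (f, i)" "f \<in> ?F k" "i < n" by blast
    then show "(case fi of (f, i) \<Rightarrow> f(k := i)) \<in> ?F (Suc k)"
      by (auto simp: less_Suc_eq)
    show "((case fi of (f, i) \<Rightarrow> f(k := i))(k := k), (case fi of (f, i) \<Rightarrow> f(k := i)) k) = fi"
      using fi by auto
    have "(\<Prod>j<k. a ((f(k := i)) j) j) = (\<Prod>j<k. a (f j) j)" by (rule prod.cong) auto
    moreover have "(\<lambda>j. if j < Suc k then e ((f(k := i)) j) else z j) = (?y f)(k := e i)"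
      by (auto simp: less_Suc_eq)
    ultimately show "(\<Prod>j<Suc k. a ((case fi of (f, i) \<Rightarrow> f(k := i)) j) j) *
        \<phi> (\<lambda>j. if j < Suc k then e ((case fi of (f, i) \<Rightarrow> f(k := i)) j) else z j) =
        (case fi of (f, i) \<Rightarrow> (\<Prod>j<k. a (f j) j) * (a i k * \<phi> ((?y f)(k := e i))))"
      unfolding fi(1) prod.case by (simp add: mult.assoc)
  next
    fix f assume f: "f \<in> ?F (Suc k)"
    then show "(f(k := k), f k) \<in> ?F k \<times> {..<n}" by (auto simp: less_Suc_eq)
    show "(case (f(k := k), f k) of (f, i) \<Rightarrow> f(k := i)) = f" by auto
  qed
  finally show ?case .
qed

text \<open>The coefficient of \<open>\<phi> e\<close> is the Leibniz formula for the determinant of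
  \<open>a\<close>: in the full expansion, index functions that are not permutations repeat a vector
  and contribute zero.\<close>

lemma alternating_multilinear_expand:
  fixes e :: "nat \<Rightarrow> 'v::real_vector"
  assumes \<phi>: "multilinear_form n \<phi>" and alt: "alternating n \<phi>"
    and x: "\<And>j. j < n \<Longrightarrow> x j = (\<Sum>i<n. a i j *\<^sub>R e i)"
  shows "\<phi> x = (\<Sum>\<pi> | \<pi> permutes {..<n}. of_int (sign \<pi>) * (\<Prod>j<n. a (\<pi> j) j)) * \<phi> e"
proof -
  let ?F = "{f. (\<forall>i<n. f i < n) \<and> (\<forall>i\<ge>n. f i = i)}"
  have fin: "finite ?F"
  proof (rule finite_subset)
    show "?F \<subseteq> (\<lambda>g i. if i < n then g i else i) ` ({..<n} \<rightarrow>\<^sub>E {..<n})"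
    proof
      fix f assume "f \<in> ?F"
      then show "f \<in> (\<lambda>g i. if i < n then g i else i) ` ({..<n} \<rightarrow>\<^sub>E {..<n})"
        by (intro image_eqI[where x = "restrict f {..<n}"]) auto
    qed
  qed (intro finite_imageI finite_PiE, auto)
  have sub: "{\<pi>. \<pi> permutes {..<n}} \<subseteq> ?F"
  proof (rule subsetI, drule CollectD)
    fix \<pi> :: "nat \<Rightarrow> nat" assume \<pi>: "\<pi> permutes {..<n}"
    have "\<pi> i < n" if "i < n" for i using permutes_in_image[OF \<pi>, of i] that by simp
    moreover have "\<pi> i = i" if "i \<ge> n" for i using permutes_not_in[OF \<pi>, of i] that by simp
    ultimately show "\<pi> \<in> ?F" by blast
  qed
  have zero: "\<phi> (e \<circ> f) = 0" if f: "f \<in> ?F" "\<not> f permutes {..<n}" for f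
  proof -
    have "\<not> inj_on f {..<n}"
    proof
      assume "inj_on f {..<n}"
      moreover have "f ` {..<n} \<subseteq> {..<n}" using f(1) by blast
      ultimately have "bij_betw f {..<n} {..<n}"
        by (simp add: bij_betw_def endo_inj_surj)
      moreover have "f i = i" if "i \<notin> {..<n}" for i using f(1) that by simp
      ultimately have "f permutes {..<n}" by (rule bij_imp_permutes)
      with f show False by simp
    qed
    then obtain i j where ij: "i < n" "j < n" "i \<noteq> j" "f i = f j"
      unfolding inj_on_def by auto
    \<comment> \<open>Swapping two positions that hold the same vector leaves
      \<open>e \<circ> f\<close> unchanged but reverses the sign of \<open>\<phi>\<close>.\<close>
    let ?t = "Transposition.transpose i j"
    have "e \<circ> f \<circ> ?t = e \<circ> f" using ij by (auto simp: Transposition.transpose_def)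
    moreover have "?t permutes {..<n}" using ij by (simp add: permutes_swap_id)
    ultimately have "\<phi> (e \<circ> f) = of_int (sign ?t) * \<phi> (e \<circ> f)"
      using alt unfolding alternating_def by metis
    then show ?thesis using ij by (simp add: sign_swap_id)
  qed
  have "\<phi> x = \<phi> (\<lambda>j. if j < n then x j else e j)"
    by (rule multilinear_form_local[OF \<phi>]) simp
  also have "\<dots> = (\<Sum>f\<in>?F. (\<Prod>j<n. a (f j) j) * \<phi> (\<lambda>j. if j < n then e (f j) else e j))"
    by (rule multilinear_form_expand[OF \<phi> order_refl x])
  also have "\<dots> = (\<Sum>f\<in>?F. (\<Prod>j<n. a (f j) j) * \<phi> (e \<circ> f))"
    by (intro sum.cong refl arg_cong2[where f = "(*)"] multilinear_form_local[OF \<phi>]) simp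
  also have "\<dots> = (\<Sum>f | f permutes {..<n}. (\<Prod>j<n. a (f j) j) * \<phi> (e \<circ> f))"
    by (rule sum.mono_neutral_right[OF fin sub]) (auto simp: zero)
  also have "\<dots> = (\<Sum>\<pi> | \<pi> permutes {..<n}. of_int (sign \<pi>) * (\<Prod>j<n. a (\<pi> j) j) * \<phi> e)"
    using alt by (intro sum.cong) (auto simp: alternating_def)
  finally show ?thesis by (simp add: sum_distrib_right)
qed

lemma top_dform_zero:
  fixes e :: "nat \<Rightarrow> 'v::real_vector"
  assumes \<omega>: "multilinear_dform n n \<omega>"
    and alt: "\<And>y. alternating n (\<lambda>x. \<omega> x y)" "\<And>x. alternating n (\<omega> x)"
    and T: "\<And>j. j < n \<Longrightarrow> T (e j) = (\<Sum>i<n. a i j *\<^sub>R e i)"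
    and anti: "\<omega> (T \<circ> e) (T \<circ> e) = - \<omega> e e"
  shows "\<omega> e e = 0"
proof -
  \<comment> \<open>The determinant of the coefficient matrix of \<open>T\<close> on
    \<open>e\<close>. Each group of arguments contributes it once, so anti-invariance becomes
    \<open>\<delta>\<^sup>2 * \<omega> e e = - \<omega> e e\<close> with \<open>\<delta>\<close>
    real.\<close>
  define \<delta> :: real where
    "\<delta> = (\<Sum>\<pi> | \<pi> permutes {..<n}. of_int (sign \<pi>) * (\<Prod>j<n. a (\<pi> j) j))"
  have "\<omega> (T \<circ> e) (T \<circ> e) = \<delta> * \<omega> e (T \<circ> e)"
    unfolding \<delta>_def using T \<omega> alt(1)
    by (intro alternating_multilinear_expand[where \<phi> = "\<lambda>x. \<omega> x (T \<circ> e)"])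
       (auto simp: multilinear_dform_def)
  also have "\<omega> e (T \<circ> e) = \<delta> * \<omega> e e"
    unfolding \<delta>_def using T \<omega> alt(2)
    by (intro alternating_multilinear_expand[where \<phi> = "\<omega> e"]) (auto simp: multilinear_dform_def)
  finally have "(\<delta>\<^sup>2 + 1) * \<omega> e e = 0" unfolding anti by (simp add: power2_eq_square algebra_simps)
  moreover have "\<delta>\<^sup>2 + 1 > 0" by (simp add: add_nonneg_pos)
  ultimately show ?thesis by simp
qed

text \<open>One rule with two uses: factors \<open>1\<close> and \<open>1\<close> give invariance of
  powers, while \<open>1\<close> and \<open>-1\<close> let a single anti-invariant factor change the
  sign of a product.\<close>

lemma dprod_scale:
  assumes "\<And>x y. \<alpha> (T \<circ> x) (T \<circ> y) = a * \<alpha> x y" "\<And>x y. \<beta> (T \<circ> x) (T \<circ> y) = b * \<beta> x y"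
  shows "dprod p q r s \<alpha> \<beta> (T \<circ> x) (T \<circ> y) = a * b * dprod p q r s \<alpha> \<beta> x y"
proof -
  have "\<alpha> (\<lambda>i. T (x (\<sigma> i))) (\<lambda>i. T (y (\<tau> i))) = a * \<alpha> (\<lambda>i. x (\<sigma> i)) (\<lambda>i. y (\<tau> i))"
    and "\<beta> (\<lambda>i. T (x (\<sigma> i))) (\<lambda>i. T (y (\<tau> i))) = b * \<beta> (\<lambda>i. x (\<sigma> i)) (\<lambda>i. y (\<tau> i))"
    for \<sigma> \<tau> :: "nat \<Rightarrow> nat"
    using assms[of "\<lambda>i. x (\<sigma> i)" "\<lambda>i. y (\<tau> i)"] by (simp_all add: comp_def)
  then show ?thesis unfolding dprod_def by (simp add: sum_distrib_left mult_ac)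
qed

lemma dpower_invariant:
  assumes "\<And>x y. \<alpha> (T \<circ> x) (T \<circ> y) = \<alpha> x y"
  shows "dpower p q \<alpha> k (T \<circ> x) (T \<circ> y) = dpower p q \<alpha> k x y"
proof (induction k arbitrary: x y)
  case (Suc k)
  have "dprod (k * p) (k * q) p q (dpower p q \<alpha> k) \<alpha> (T \<circ> x) (T \<circ> y) =
      1 * 1 * dprod (k * p) (k * q) p q (dpower p q \<alpha> k) \<alpha> x y"
    by (rule dprod_scale) (simp_all only: Suc assms mult_1)
  then show ?case by (simp only: dpower.simps mult_1)
qed simp

text \<open>The star of an anti-invariant top form vanishes: the orthonormal bases \<open>e\<close> and \<open>T \<circ> e\<close> give
  the same value up to the factor \<open>(det T)\<^sup>2\<close>, which is not \<open>-1\<close>.\<close>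

lemma gauss_bonnet_odd_eq_0:
  fixes b :: "'v::euclidean_space \<Rightarrow> 'v \<Rightarrow> real" and R :: "'v dform"
  assumes b: "bilinear b" and R: "multilinear_dform 2 2 R" and c: "bilinear c"
    and ex: "\<exists>e. orthonormal_basis b e"
    and expand: "\<And>e v. orthonormal_basis b e \<Longrightarrow> v = (\<Sum>i<DIM('v). b v (e i) *\<^sub>R e i)"
    and bT: "\<And>u v. b (T u) (T v) = b u v"
    and RT: "\<And>x y. R (T \<circ> x) (T \<circ> y) = R x y"
    and cT: "\<And>u v. c (T u) (T v) = - c u v"
  shows "gauss_bonnet_odd k b R c = 0"
proof (cases "2 * k + 1 \<le> DIM('v)")
  case True
  define m where "m = DIM('v) - 2 * k - 1"
  \<comment> \<open>The degrees add up to the dimension, so the product is a top form and the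
    determinant argument applies.\<close>
  have m: "m + (2 * k + 1) = DIM('v)" using True by (simp add: m_def)
  define \<omega> where "\<omega> = dprod m m (2 * k + 1) (2 * k + 1)
           (\<lambda>x y. dpower 1 1 (bilinear_dform b) m x y / fact m)
           (dprod (2 * k) (2 * k) 1 1 (dpower 2 2 R k) (bilinear_dform c))"
  have "multilinear_dform (m * 1) (m * 1) (dpower 1 1 (bilinear_dform b) m)"
    by (intro dpower_multilinear bilinear_dform_multilinear b)
  then have "multilinear_dform m m (dpower 1 1 (bilinear_dform b) m)" by simp
  moreover have "multilinear_dform (2 * k) (2 * k) (dpower 2 2 R k)"
    using dpower_multilinear[OF R, of k] by (simp add: mult.commute)
  ultimately have "multilinear_dform (m + (2 * k + 1)) (m + (2 * k + 1)) \<omega>"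
    unfolding \<omega>_def
    by (intro dprod_multilinear multilinear_dform_divide bilinear_dform_multilinear c)
  then have \<omega>: "multilinear_dform DIM('v) DIM('v) \<omega>" unfolding m .
  have alt1: "alternating DIM('v) (\<lambda>x. \<omega> x y)" for y
    unfolding m[symmetric] \<omega>_def by (rule dprod_alternating_left)
  have alt2: "alternating DIM('v) (\<omega> x)" for x
    unfolding m[symmetric] \<omega>_def by (rule dprod_alternating_right)
  have anti: "\<omega> (T \<circ> x) (T \<circ> y) = - \<omega> x y" for x y
  proof -
    have "dpower 1 1 (bilinear_dform b) m (T \<circ> x) (T \<circ> y) = dpower 1 1 (bilinear_dform b) m x y" for x y
      by (rule dpower_invariant) (simp add: bilinear_dform_def bT)
    moreover have "dprod (2 * k) (2 * k) 1 1 (dpower 2 2 R k) (bilinear_dform c) (T \<circ> x) (T \<circ> y) =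
        1 * (-1) * dprod (2 * k) (2 * k) 1 1 (dpower 2 2 R k) (bilinear_dform c) x y" for x y
      by (rule dprod_scale) (simp_all add: bilinear_dform_def cT dpower_invariant RT)
    ultimately have "\<omega> (T \<circ> x) (T \<circ> y) = 1 * (-1) * \<omega> x y"
      unfolding \<omega>_def by (intro dprod_scale) simp_all
    then show ?thesis by simp
  qed
  have zero: "\<omega> e e = 0" if e: "orthonormal_basis b e" for e
    by (rule top_dform_zero[OF \<omega> alt1 alt2, where T = T and a = "\<lambda>i j. b (T (e j)) (e i)"])
       (auto intro: expand[OF e] anti)
  \<comment> \<open>Every orthonormal basis gives 0, so 0 satisfies the description; existence of
    one basis excludes any other value.\<close>
  have "hodge_star b \<omega> = 0"
    unfolding hodge_star_def using ex zero by (intro the_equality) blast+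
  then show ?thesis using True by (simp add: gauss_bonnet_odd_def Let_def \<omega>_def m_def)
qed (simp add: gauss_bonnet_odd_def)

section \<open>Differential calculus\<close>

text \<open>The second difference is symmetric in \<open>u\<close> and \<open>v\<close>, so
  recognizing its limit as one mixed derivative identifies it with the other as well. The mean value
  theorem in direction \<open>u\<close> turns it into a difference of first derivatives, and the
  derivative of these at \<open>x\<close> controls that difference.\<close>

lemma second_difference_tendsto:
  fixes \<phi> :: "'a::real_normed_vector \<Rightarrow> real"
  assumes S: "open S" "x \<in> S" and \<phi>: "\<And>y. y \<in> S \<Longrightarrow> \<phi> differentiable (at y)"
    and \<phi>u: "(\<lambda>y. D \<phi> y u) differentiable (at x)"
  shows "((\<lambda>t. (\<phi> (x + t *\<^sub>R u + t *\<^sub>R v) - \<phi> (x + t *\<^sub>R u) - \<phi> (x + t *\<^sub>R v) + \<phi> x) / t\<^sup>2)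
    \<longlongrightarrow> D (\<lambda>y. D \<phi> y u) x v) (at_right 0)"
proof (rule tendstoI)
  fix \<epsilon> :: real assume \<epsilon>: "\<epsilon> > 0"
  define L where "L = D (\<lambda>y. D \<phi> y u) x"
  define M where "M = norm u + norm v"
  \<comment> \<open>The final error is \<open>2 * \<eta> * M\<close>, which is then below
    \<open>\<epsilon>\<close>; the summand 1 keeps the denominator positive when \<open>u\<close>
    and \<open>v\<close> both vanish.\<close>
  define \<eta> where "\<eta> = \<epsilon> / (2 * (2 * M + 1))"
  have M: "M \<ge> 0" by (simp add: M_def)
  have \<eta>: "\<eta> > 0" using \<epsilon> M by (simp add: \<eta>_def)
  have L: "((\<lambda>y. D \<phi> y u) has_derivative L) (at x)"
    using \<phi>u unfolding L_def frechet_derivative_works .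
  then have linL: "linear L" by (rule has_derivative_linear)
  obtain d1 where d1: "d1 > 0" and
    d1_bound: "\<And>y. norm (y - x) < d1 \<Longrightarrow> norm (D \<phi> y u - D \<phi> x u - L (y - x)) \<le> \<eta> * norm (y - x)"
    using L \<eta> unfolding has_derivative_at_alt by blast
  obtain d2 where d2: "d2 > 0" "ball x d2 \<subseteq> S" using S openE by blast
  define d where "d = min d1 d2"
  have d: "d > 0" using d1 d2 by (simp add: d_def)
  have "dist ((\<phi> (x + t *\<^sub>R u + t *\<^sub>R v) - \<phi> (x + t *\<^sub>R u) - \<phi> (x + t *\<^sub>R v) + \<phi> x) / t\<^sup>2) (L v) < \<epsilon>"
    if t: "0 < t" "t < d / (M + 1)" for t
  proof -
    have tM: "t * (M + 1) < d" using t M by (simp add: pos_less_divide_eq)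
    have small: "norm (s *\<^sub>R u + r *\<^sub>R v) \<le> t * M \<and> norm (s *\<^sub>R u + r *\<^sub>R v) < d"
      if "0 \<le> s" "s \<le> t" "0 \<le> r" "r \<le> t" for s r
    proof -
      have "norm (s *\<^sub>R u + r *\<^sub>R v) \<le> s * norm u + r * norm v"
        using norm_triangle_ineq[of "s *\<^sub>R u" "r *\<^sub>R v"] that by simp
      also have "\<dots> \<le> t * norm u + t * norm v"
        using that by (intro add_mono mult_right_mono) auto
      also have "\<dots> = t * M" by (simp add: M_def algebra_simps)
      finally have "norm (s *\<^sub>R u + r *\<^sub>R v) \<le> t * M" .
      moreover have "t * M < d" using tM t(1) by (simp add: algebra_simps)
      ultimately show ?thesis by linarith
    qed
    have inS: "x + s *\<^sub>R u + r *\<^sub>R v \<in> S" if "0 \<le> s" "s \<le> t" "0 \<le> r" "r \<le> t" for s r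
    proof -
      have "dist x (x + s *\<^sub>R u + r *\<^sub>R v) = norm (s *\<^sub>R u + r *\<^sub>R v)"
        using norm_minus_cancel[of "s *\<^sub>R u + r *\<^sub>R v"] by (simp add: dist_norm algebra_simps)
      then show ?thesis using small[OF that] d2(2) by (auto simp: d_def)
    qed
    \<comment> \<open>The second difference is \<open>?\<psi> t - ?\<psi> 0\<close>. The term
      \<open>0 *\<^sub>R v\<close> gives both summands the shape of \<open>der1\<close>, used with
      \<open>r = t\<close> and with \<open>r = 0\<close>.\<close>
    let ?\<psi> = "\<lambda>s. \<phi> (x + s *\<^sub>R u + t *\<^sub>R v) - \<phi> (x + s *\<^sub>R u + 0 *\<^sub>R v)"
    let ?\<psi>' = "\<lambda>s. D \<phi> (x + s *\<^sub>R u + t *\<^sub>R v) u - D \<phi> (x + s *\<^sub>R u + 0 *\<^sub>R v) u"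
    have der1: "((\<lambda>s. \<phi> (x + s *\<^sub>R u + r *\<^sub>R v)) has_derivative (\<lambda>l. l * D \<phi> (x + s *\<^sub>R u + r *\<^sub>R v) u)) (at s)"
      if "0 \<le> s" "s \<le> t" "0 \<le> r" "r \<le> t" for s r
    proof -
      have *: "(\<phi> has_derivative D \<phi> (x + s *\<^sub>R u + r *\<^sub>R v)) (at (x + s *\<^sub>R u + r *\<^sub>R v))"
        using \<phi>[OF inS[OF that]] by (simp add: frechet_derivative_works)
      have "((\<lambda>s. x + s *\<^sub>R u + r *\<^sub>R v) has_derivative (\<lambda>l. l *\<^sub>R u)) (at s)"
        by (auto intro!: derivative_eq_intros)
      from diff_chain_at[OF this *] has_derivative_linear[OF *]
      show ?thesis by (simp add: comp_def linear_cmul)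
    qed
    have der: "(?\<psi> has_derivative (\<lambda>l. l * ?\<psi>' s)) (at s)" if "0 \<le> s" "s \<le> t" for s
      using has_derivative_diff[OF der1[OF that, of t] der1[OF that, of 0]] t
      by (simp add: algebra_simps)
    have "\<exists>s\<in>{0<..<t}. ?\<psi> t - ?\<psi> 0 = (\<lambda>s l. l * ?\<psi>' s) s (t - 0)"
    proof (rule mvt_simple[OF t(1)])
      fix s assume "0 \<le> s" "s \<le> t"
      then show "(?\<psi> has_derivative (\<lambda>l. l * ?\<psi>' s)) (at s within {0..t})"
        by (rule has_derivative_at_withinI[OF der])
    qed
    then obtain s where s: "s \<in> {0<..<t}" and mvt0: "?\<psi> t - ?\<psi> 0 = (t - 0) * ?\<psi>' s" ..
    from s have s: "0 < s" "s < t" by auto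
    note mvt = mvt0[unfolded diff_zero]
    have bound: "\<bar>D \<phi> (x + s *\<^sub>R u + r *\<^sub>R v) u - D \<phi> x u - L (s *\<^sub>R u + r *\<^sub>R v)\<bar> \<le> \<eta> * (t * M)"
      if "0 \<le> r" "r \<le> t" for r
    proof -
      have "norm (D \<phi> (x + s *\<^sub>R u + r *\<^sub>R v) u - D \<phi> x u - L (s *\<^sub>R u + r *\<^sub>R v))
          \<le> \<eta> * norm (s *\<^sub>R u + r *\<^sub>R v)"
        using d1_bound[of "x + s *\<^sub>R u + r *\<^sub>R v"] small[of s r] s that
        by (simp add: d_def add.assoc)
      also have "\<dots> \<le> \<eta> * (t * M)" using small[of s r] s that \<eta> by (intro mult_left_mono) auto
      finally show ?thesis by simp
    qed
    \<comment> \<open>The unknown intermediate point \<open>s\<close> drops out: both linear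
      approximations contain \<open>L (s *\<^sub>R u)\<close>, and only the increment in direction
      \<open>v\<close> remains.\<close>
    have "L (s *\<^sub>R u + t *\<^sub>R v) - L (s *\<^sub>R u + 0 *\<^sub>R v) = t * L v"
      using linL by (simp add: linear_add linear_cmul)
    then have *: "\<bar>?\<psi>' s - t * L v\<bar> \<le> 2 * \<eta> * t * M"
      using bound[of t] bound[of 0] t by (simp add: algebra_simps)
    have "\<bar>(?\<psi> t - ?\<psi> 0) / t\<^sup>2 - L v\<bar> = \<bar>?\<psi>' s - t * L v\<bar> / t"
    proof -
      have "(?\<psi> t - ?\<psi> 0) / t\<^sup>2 - L v = (?\<psi>' s - t * L v) / t"
        unfolding mvt using t by (simp add: field_simps power2_eq_square)
      then show ?thesis using t by simp
    qed
    also have "\<dots> \<le> 2 * \<eta> * M" using * t by (simp add: pos_divide_le_eq algebra_simps)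
    also have "\<dots> < \<epsilon>" using \<epsilon> M by (simp add: \<eta>_def field_simps add_pos_nonneg)
    finally show ?thesis by (simp add: dist_real_def algebra_simps)
  qed
  moreover have "d / (M + 1) > 0" using d M by simp
  ultimately show "\<forall>\<^sub>F t in at_right 0. dist ((\<phi> (x + t *\<^sub>R u + t *\<^sub>R v) - \<phi> (x + t *\<^sub>R u)
      - \<phi> (x + t *\<^sub>R v) + \<phi> x) / t\<^sup>2) (D (\<lambda>y. D \<phi> y u) x v) < \<epsilon>"
    unfolding L_def[symmetric] eventually_at_right_field by blast
qed

lemma second_derivative_symmetric_real:
  fixes \<phi> :: "'a::real_normed_vector \<Rightarrow> real"
  assumes S: "open S" "x \<in> S" and \<phi>: "\<And>y. y \<in> S \<Longrightarrow> \<phi> differentiable (at y)"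
    and \<phi>2: "\<And>u. (\<lambda>y. D \<phi> y u) differentiable (at x)"
  shows "D (\<lambda>y. D \<phi> y u) x v = D (\<lambda>y. D \<phi> y v) x u"
proof -
  have eq: "(\<lambda>t. (\<phi> (x + t *\<^sub>R v + t *\<^sub>R u) - \<phi> (x + t *\<^sub>R v) - \<phi> (x + t *\<^sub>R u) + \<phi> x) / t\<^sup>2) =
    (\<lambda>t. (\<phi> (x + t *\<^sub>R u + t *\<^sub>R v) - \<phi> (x + t *\<^sub>R u) - \<phi> (x + t *\<^sub>R v) + \<phi> x) / t\<^sup>2)"
    by (simp add: algebra_simps)
  show ?thesis
    using second_difference_tendsto[OF S \<phi> \<phi>2, of u v] second_difference_tendsto[OF S \<phi> \<phi>2, of v u]
    unfolding eq by (intro tendsto_unique[OF trivial_limit_at_right_real])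
qed

section \<open>Derivatives of smooth maps and of families of bilinear forms\<close>

lemma frechet_derivative_eqI: "(F has_derivative F') (at x) \<Longrightarrow> D F x = F'"
  by (rule frechet_derivative_at[symmetric])

lemma frechet_derivative_bounded_linear:
  assumes "bounded_linear L" "F differentiable (at x)"
  shows "D (\<lambda>y. L (F y)) x u = L (D F x u)"
proof -
  have "((\<lambda>y. L (F y)) has_derivative (\<lambda>u. L (D F x u))) (at x)"
    by (rule bounded_linear.has_derivative[OF assms(1)])
       (use assms(2) in \<open>simp add: frechet_derivative_works\<close>)
  then show ?thesis by (simp add: frechet_derivative_eqI)
qed

lemma differentiable_transform_open:
  assumes "F differentiable (at x)" "open S" "x \<in> S" "\<And>y. y \<in> S \<Longrightarrow> F y = G y"
  shows "G differentiable (at x)"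
  using assms unfolding differentiable_def by (meson has_derivative_transform_within_open)

lemma smooth_on_differentiable: "smooth_on S F \<Longrightarrow> x \<in> S \<Longrightarrow> F differentiable (at x)"
  unfolding smooth_on_def by (metis Ck_on.simps(2))

lemma smooth_on_directional: "smooth_on S F \<Longrightarrow> smooth_on S (\<lambda>x. D F x v)"
  unfolding smooth_on_def by (metis Ck_on.simps(2))

lemma second_derivative_symmetric:
  fixes F :: "'a::real_normed_vector \<Rightarrow> 'b::euclidean_space"
  assumes S: "open S" "x \<in> S" and F: "smooth_on S F"
  shows "D (\<lambda>y. D F y u) x v = D (\<lambda>y. D F y v) x u"
proof (rule euclidean_eqI)
  fix b :: 'b assume "b \<in> Basis"
  have 1: "D (\<lambda>y. F y \<bullet> b) y w = D F y w \<bullet> b" if "y \<in> S" for y w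
    by (rule frechet_derivative_bounded_linear[OF bounded_linear_inner_left
          smooth_on_differentiable[OF F that]])
  have dF: "(\<lambda>y. D F y w) differentiable (at x)" for w
    by (rule smooth_on_differentiable[OF smooth_on_directional[OF F] S(2)])
  have dFb: "(\<lambda>y. D F y w \<bullet> b) differentiable (at x)" for w
    using dF[of w] by (auto simp: differentiable_def intro: derivative_intros)
  have diff: "(\<lambda>y. D (\<lambda>y. F y \<bullet> b) y w) differentiable (at x)" for w
    by (rule differentiable_transform_open[OF dFb S]) (simp add: 1)
  have 2: "D (\<lambda>y. D (\<lambda>y. F y \<bullet> b) y w) x z = D (\<lambda>y. D F y w) x z \<bullet> b" for w z
  proof -
    have "D (\<lambda>y. D (\<lambda>y. F y \<bullet> b) y w) x = D (\<lambda>y. D F y w \<bullet> b) x"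
      by (rule frechet_derivative_transform_within_open[OF diff S]) (rule 1)
    then show ?thesis
      by (simp add: frechet_derivative_bounded_linear[OF bounded_linear_inner_left dF])
  qed
  have "D (\<lambda>y. D (\<lambda>y. F y \<bullet> b) y u) x v = D (\<lambda>y. D (\<lambda>y. F y \<bullet> b) y v) x u"
  proof (rule second_derivative_symmetric_real[OF S _ diff])
    fix y assume "y \<in> S"
    from smooth_on_differentiable[OF F this]
    show "(\<lambda>y. F y \<bullet> b) differentiable (at y)"
      by (auto simp: differentiable_def intro: derivative_intros)
  qed
  then show "D (\<lambda>y. D F y u) x v \<bullet> b = D (\<lambda>y. D F y v) x u \<bullet> b" unfolding 2 .
qed

lemma bilinear_expand:
  fixes B :: "'a::euclidean_space \<Rightarrow> 'b::euclidean_space \<Rightarrow> real"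
  assumes "bilinear B"
  shows "B u v = (\<Sum>i\<in>Basis. \<Sum>j\<in>Basis. (u \<bullet> i) * (v \<bullet> j) * B i j)"
proof -
  have "B u v = B (\<Sum>i\<in>Basis. (u \<bullet> i) *\<^sub>R i) (\<Sum>j\<in>Basis. (v \<bullet> j) *\<^sub>R j)"
    by (simp add: euclidean_representation)
  also have "\<dots> = (\<Sum>(i, j)\<in>Basis \<times> Basis. (u \<bullet> i) * (v \<bullet> j) * B i j)"
    using bilinear_sum[OF assms, of "\<lambda>i. (u \<bullet> i) *\<^sub>R i" Basis "\<lambda>j. (v \<bullet> j) *\<^sub>R j" Basis]
    by (simp add: bilinear_lmul[OF assms] bilinear_rmul[OF assms] mult_ac)
  finally show ?thesis by (simp add: sum.cartesian_product)
qed

text \<open>A product rule with three factors, for a metric that varies with the point. Derivatives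
  of \<open>H\<close> are given for constant arguments only, hence the expansion in the Euclidean
  basis, which turns the expression into finite sums of products of real functions.\<close>

lemma has_derivative_bilinear_family:
  fixes H :: "'c::real_normed_vector \<Rightarrow> 'a::euclidean_space \<Rightarrow> 'b::euclidean_space \<Rightarrow> real"
  assumes S: "open S" "x \<in> S" and bil: "\<And>y. y \<in> S \<Longrightarrow> bilinear (H y)"
    and H: "\<And>u v. ((\<lambda>y. H y u v) has_derivative H' u v) (at x)"
    and P: "(P has_derivative P') (at x)" and Q: "(Q has_derivative Q') (at x)"
  shows "((\<lambda>y. H y (P y) (Q y)) has_derivative
    (\<lambda>w. H' (P x) (Q x) w + H x (P' w) (Q x) + H x (P x) (Q' w))) (at x)"
proof -
  \<comment> \<open>Bilinearity of \<open>H'\<close> is not assumed; it is inherited from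
    \<open>H\<close> by uniqueness of derivatives.\<close>
  have H'_expand: "H' u v w = (\<Sum>i\<in>Basis. \<Sum>j\<in>Basis. (u \<bullet> i) * (v \<bullet> j) * H' i j w)" for u v w
  proof -
    have "((\<lambda>y. \<Sum>i\<in>Basis. \<Sum>j\<in>Basis. (u \<bullet> i) * (v \<bullet> j) * H y i j) has_derivative
        (\<lambda>w. \<Sum>i\<in>Basis. \<Sum>j\<in>Basis. (u \<bullet> i) * (v \<bullet> j) * H' i j w)) (at x)"
      by (intro derivative_intros H)
    then have "((\<lambda>y. H y u v) has_derivative
        (\<lambda>w. \<Sum>i\<in>Basis. \<Sum>j\<in>Basis. (u \<bullet> i) * (v \<bullet> j) * H' i j w)) (at x)"
      by (rule has_derivative_transform_within_open[OF _ S]) (rule bilinear_expand[symmetric, OF bil])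
    from has_derivative_unique[OF H this] show ?thesis by (rule fun_cong)
  qed
  have "((\<lambda>y. \<Sum>i\<in>Basis. \<Sum>j\<in>Basis. (P y \<bullet> i) * (Q y \<bullet> j) * H y i j) has_derivative
      (\<lambda>w. \<Sum>i\<in>Basis. \<Sum>j\<in>Basis. (P x \<bullet> i) * (Q x \<bullet> j) * H' i j w
        + ((P x \<bullet> i) * (Q' w \<bullet> j) + (P' w \<bullet> i) * (Q x \<bullet> j)) * H x i j)) (at x)"
    by (intro derivative_intros H P Q)
  then have "((\<lambda>y. H y (P y) (Q y)) has_derivative
      (\<lambda>w. \<Sum>i\<in>Basis. \<Sum>j\<in>Basis. (P x \<bullet> i) * (Q x \<bullet> j) * H' i j w
        + ((P x \<bullet> i) * (Q' w \<bullet> j) + (P' w \<bullet> i) * (Q x \<bullet> j)) * H x i j)) (at x)"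
    by (rule has_derivative_transform_within_open[OF _ S]) (rule bilinear_expand[symmetric, OF bil])
  moreover have "(\<lambda>w. \<Sum>i\<in>Basis. \<Sum>j\<in>Basis. (P x \<bullet> i) * (Q x \<bullet> j) * H' i j w
        + ((P x \<bullet> i) * (Q' w \<bullet> j) + (P' w \<bullet> i) * (Q x \<bullet> j)) * H x i j) =
      (\<lambda>w. H' (P x) (Q x) w + H x (P' w) (Q x) + H x (P x) (Q' w))"
    by (simp add: H'_expand[of "P x" "Q x"] bilinear_expand[OF bil[OF S(2)], of "P x"]
        bilinear_expand[OF bil[OF S(2)], of "P' _"] sum.distrib algebra_simps)
  ultimately show ?thesis by simp
qed

section \<open>Linear algebra of scalar products\<close>

locale scalar_product =
  fixes b :: "'v::euclidean_space \<Rightarrow> 'v \<Rightarrow> real"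
  assumes bilinear: "bilinear b" and sym: "b u v = b v u" and pos: "u \<noteq> 0 \<Longrightarrow> b u u > 0"
begin

lemmas bsimps = bilinear_ladd[OF bilinear] bilinear_radd[OF bilinear] bilinear_lsub[OF bilinear]
  bilinear_rsub[OF bilinear] bilinear_lmul[OF bilinear] bilinear_rmul[OF bilinear]
  bilinear_lneg[OF bilinear] bilinear_rneg[OF bilinear] bilinear_lzero[OF bilinear]
  bilinear_rzero[OF bilinear]

lemma linear_left: "linear (\<lambda>u. b u v)" and linear_right: "linear (b u)"
  using bilinear by (auto simp: bilinear_def)

lemma sum_left: "b (\<Sum>i\<in>I. c i *\<^sub>R w i) v = (\<Sum>i\<in>I. c i * b (w i) v)"
  by (simp add: linear_sum[OF linear_left] bsimps)

lemma eqI: "(\<And>z. b u z = b v z) \<Longrightarrow> u = v"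
  using pos[of "u - v"] by (force simp: bsimps)

text \<open>\<open>orthonormal_basis\<close> only prescribes inner products, so spanning has to be
  proved. The coordinate map \<open>L\<close> is onto because it sends the combination of the
  \<open>e i\<close> with coefficients \<open>z \<bullet> \<beta> i\<close> to \<open>z\<close>; by
  equality of dimensions it is injective, and both sides have the same coordinates.\<close>

lemma orthonormal_basis_expand:
  assumes e: "orthonormal_basis b e"
  shows "v = (\<Sum>i<DIM('v). b v (e i) *\<^sub>R e i)"
proof -
  obtain \<beta> :: "nat \<Rightarrow> 'v" where "bij_betw \<beta> {0..<DIM('v)} Basis"
    using ex_bij_betw_nat_finite[OF finite_Basis] by blast
  then have \<beta>: "bij_betw \<beta> {..<DIM('v)} Basis" by (simp add: lessThan_atLeast0)
  define L where "L v = (\<Sum>i<DIM('v). b v (e i) *\<^sub>R \<beta> i)" for v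
  have ee: "b (e i) (e j) = (if i = j then 1 else 0)" if "i < DIM('v)" "j < DIM('v)" for i j
    using e that by (simp add: orthonormal_basis_def)
  have lin: "linear L"
    unfolding L_def by (rule linearI)
      (simp_all add: bsimps scaleR_add_left sum.distrib scaleR_sum_right)
  have "L (\<Sum>i<DIM('v). (z \<bullet> \<beta> i) *\<^sub>R e i) = z" for z
  proof -
    have "L (\<Sum>i<DIM('v). (z \<bullet> \<beta> i) *\<^sub>R e i) =
        (\<Sum>j<DIM('v). (\<Sum>i<DIM('v). (z \<bullet> \<beta> i) * (if i = j then 1 else 0)) *\<^sub>R \<beta> j)"
      unfolding L_def sum_left by (intro sum.cong refl arg_cong2[where f = scaleR]) (auto simp: ee)
    also have "\<dots> = (\<Sum>j<DIM('v). (z \<bullet> \<beta> j) *\<^sub>R \<beta> j)"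
      by (intro sum.cong refl arg_cong2[where f = scaleR]) (simp add: if_distrib cong: if_cong)
    also have "\<dots> = (\<Sum>c\<in>Basis. (z \<bullet> c) *\<^sub>R c)"
      by (rule sum.reindex_bij_betw[OF \<beta>])
    finally show ?thesis by (simp add: euclidean_representation)
  qed
  then have "surj L" by (rule surjI)
  then have "inj L" using linear_surjective_imp_injective[OF lin] by simp
  moreover have "L v = L (\<Sum>i<DIM('v). b v (e i) *\<^sub>R e i)"
  proof -
    have "b (\<Sum>i<DIM('v). b v (e i) *\<^sub>R e i) (e j) = b v (e j)" if "j < DIM('v)" for j
    proof -
      have "b (\<Sum>i<DIM('v). b v (e i) *\<^sub>R e i) (e j) =
          (\<Sum>i<DIM('v). b v (e i) * (if i = j then 1 else 0))"
        unfolding sum_left using that by (intro sum.cong refl) (simp add: ee)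
      also have "\<dots> = b v (e j)" using that by (simp add: if_distrib cong: if_cong)
      finally show ?thesis .
    qed
    then show ?thesis by (simp add: L_def)
  qed
  ultimately show ?thesis by (rule injD)
qed

text \<open>The representing vector is written out in the basis, so its dependence on a point can be
  read off from that of \<open>l\<close> and \<open>e\<close>.\<close>

lemma riesz:
  assumes e: "orthonormal_basis b e" and l: "linear l"
  shows "b (\<Sum>i<DIM('v). l (e i) *\<^sub>R e i) z = l z"
proof -
  have "l z = l (\<Sum>i<DIM('v). b z (e i) *\<^sub>R e i)" using orthonormal_basis_expand[OF e] by metis
  also have "\<dots> = (\<Sum>i<DIM('v). b z (e i) * l (e i))"
    by (simp add: linear_sum[OF l] linear_cmul[OF l])
  finally show ?thesis by (simp add: sum_left sym[of z] mult.commute)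
qed

end

section \<open>Riemannian metrics on open sets\<close>

locale chart_metric =
  fixes U :: "'a::euclidean_space set" and g :: "'a \<Rightarrow> 'a \<Rightarrow> 'a \<Rightarrow> real"
  assumes open_U: "open U"
    and scalar_product: "y \<in> U \<Longrightarrow> scalar_product (g y)"
    and smooth: "smooth_on U (\<lambda>y. g y u v)"
begin

abbreviation dg :: "'a \<Rightarrow> 'a \<Rightarrow> 'a \<Rightarrow> 'a \<Rightarrow> real" where
  "dg y u v z \<equiv> D (\<lambda>y. g y v z) y u"

abbreviation \<Gamma> :: "'a \<Rightarrow> 'a \<Rightarrow> 'a \<Rightarrow> 'a" where
  "\<Gamma> \<equiv> christoffel g"

lemmas bil = scalar_product.bilinear[OF scalar_product]
lemmas sym = scalar_product.sym[OF scalar_product]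
lemmas pos = scalar_product.pos[OF scalar_product]
lemmas bsimps = scalar_product.bsimps[OF scalar_product]
lemmas metric_eqI = scalar_product.eqI[OF scalar_product]

section \<open>First derivatives of the metric\<close>

lemma has_derivative_metric:
  assumes x: "x \<in> U" and "(P has_derivative P') (at x)" "(Q has_derivative Q') (at x)"
  shows "((\<lambda>y. g y (P y) (Q y)) has_derivative
    (\<lambda>u. dg x u (P x) (Q x) + g x (P' u) (Q x) + g x (P x) (Q' u))) (at x)"
  by (rule has_derivative_bilinear_family[OF open_U x bil _ assms(2,3)])
     (use smooth_on_differentiable[OF smooth x] in \<open>simp_all add: frechet_derivative_works\<close>)

lemma differentiable_metric:
  assumes "x \<in> U" "P differentiable (at x)" "Q differentiable (at x)"
  shows "(\<lambda>y. g y (P y) (Q y)) differentiable (at x)"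
  using assms has_derivative_metric unfolding differentiable_def by blast

lemma has_derivative_dg:
  assumes "y \<in> U"
  shows "((\<lambda>y. g y v z) has_derivative (\<lambda>u. dg y u v z)) (at y)"
  using smooth_on_differentiable[OF smooth assms] by (simp add: frechet_derivative_works)

lemma linear_dg: "y \<in> U \<Longrightarrow> linear (\<lambda>u. dg y u v z)"
  using has_derivative_dg by (rule has_derivative_linear)

lemma dg_sym:
  assumes "y \<in> U" shows "dg y u v z = dg y u z v"
proof -
  have "((\<lambda>y. g y z v) has_derivative (\<lambda>u. dg y u v z)) (at y)"
    by (rule has_derivative_transform_within_open[OF has_derivative_dg open_U])
       (use assms sym in auto)
  from has_derivative_unique[OF this has_derivative_dg[OF assms]] show ?thesis by meson
qed

text \<open>Smoothness of the metric is stated for each fixed pair of arguments; linearity in them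
  passes to the derivative because derivatives are unique.\<close>

lemma linear_dg_right:
  assumes "y \<in> U" shows "linear (dg y u v)"
proof (rule linearI)
  fix z1 z2 and c :: real
  have "((\<lambda>y. g y v (z1 + z2)) has_derivative (\<lambda>u. dg y u v z1 + dg y u v z2)) (at y)"
    by (rule has_derivative_transform_within_open[OF
          has_derivative_add[OF has_derivative_dg has_derivative_dg] open_U])
       (use assms in \<open>auto simp: bsimps\<close>)
  from has_derivative_unique[OF this has_derivative_dg[OF assms]]
  show "dg y u v (z1 + z2) = dg y u v z1 + dg y u v z2" by metis
  have "((\<lambda>y. g y v (c *\<^sub>R z1)) has_derivative (\<lambda>u. c *\<^sub>R dg y u v z1)) (at y)"
    by (rule has_derivative_transform_within_open[OF
          has_derivative_scaleR_right[OF has_derivative_dg] open_U])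
       (use assms in \<open>auto simp: bsimps\<close>)
  from has_derivative_unique[OF this has_derivative_dg[OF assms]]
  show "dg y u v (c *\<^sub>R z1) = c *\<^sub>R dg y u v z1" by metis
qed

lemma linear_dg_middle:
  assumes "y \<in> U" shows "linear (\<lambda>v. dg y u v z)"
proof -
  have "(\<lambda>v. dg y u v z) = dg y u z" by (intro ext dg_sym assms)
  then show ?thesis using linear_dg_right[OF assms, where u = u and v = z] by (simp only:)
qed

lemma smooth_dg: "smooth_on U (\<lambda>y. dg y u v z)"
  by (rule smooth_on_directional[OF smooth])

subsection \<open>Orthonormal frames\<close>

text \<open>Gram-Schmidt, with parameters: the frame depends differentiably on the point.\<close>

lemma local_frame_aux:
  assumes x: "x \<in> U" and k: "k \<le> DIM('a)"
  shows "\<exists>e. (\<forall>i<k. e i differentiable (at x)) \<and>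
    (\<forall>\<^sub>F y in nhds x. \<forall>i<k. \<forall>j<k. g y (e i y) (e j y) = (if i = j then 1 else 0))"
  using k
proof (induction k)
  case 0
  show ?case by simp
next
  case (Suc k)
  then obtain e where diff: "\<And>i. i < k \<Longrightarrow> e i differentiable (at x)"
    and on: "\<forall>\<^sub>F y in nhds x. \<forall>i<k. \<forall>j<k. g y (e i y) (e j y) = (if i = j then 1 else 0)"
    by auto
  have "dim (span ((\<lambda>i. e i x) ` {..<k})) \<le> card ((\<lambda>i. e i x) ` {..<k})"
    by (simp add: dim_le_card')
  also have "\<dots> \<le> k" using card_image_le[of "{..<k}"] by simp
  also have "\<dots> < DIM('a)" using Suc.prems by simp
  finally have "span ((\<lambda>i. e i x) ` {..<k}) \<noteq> UNIV" by (metis dim_UNIV less_irrefl)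
  \<comment> \<open>This vector is fixed once, by its position at \<open>x\<close>. The projections
    that define \<open>w\<close> use the frame at \<open>y\<close>, so \<open>w\<close> inherits
    differentiability at \<open>x\<close> from the frame.\<close>
  then obtain v where v: "v \<notin> span ((\<lambda>i. e i x) ` {..<k})" by blast
  define w where "w y = v - (\<Sum>i<k. g y v (e i y) *\<^sub>R e i y)" for y
  have "w x \<noteq> 0"
  proof
    assume "w x = 0"
    then have "v = (\<Sum>i<k. g x v (e i x) *\<^sub>R e i x)" by (simp add: w_def)
    moreover have "\<dots> \<in> span ((\<lambda>i. e i x) ` {..<k})"
      by (intro span_sum span_scale span_base) auto
    ultimately show False using v by simp
  qed
  have wdiff: "w differentiable (at x)"
    unfolding w_def
    by (intro differentiable_diff differentiable_const differentiable_sum ballI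
        differentiable_scaleR differentiable_metric[OF x]) (auto intro: diff)
  then have "isCont w x" by (rule differentiable_imp_continuous_within)
  \<comment> \<open>\<open>v\<close> is independent of the frame only at \<open>x\<close>;
    continuity extends the nonvanishing of \<open>w\<close> to a neighbourhood, where normalization
    is possible.\<close>
  then have wnz: "\<forall>\<^sub>F y in nhds x. w y \<noteq> 0"
    using continuous_at_avoid[of x w 0] \<open>w x \<noteq> 0\<close>
    by (simp add: eventually_nhds_metric dist_commute)
  define N where "N y = g y (w y) (w y)" for y
  have Ndiff: "N differentiable (at x)"
    unfolding N_def by (rule differentiable_metric[OF x wdiff wdiff])
  have Npos: "N x > 0" unfolding N_def by (rule pos[OF x \<open>w x \<noteq> 0\<close>])
  define e' where "e' = e(k := \<lambda>y. inverse (sqrt (N y)) *\<^sub>R w y)"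
  have "(\<lambda>y. inverse (sqrt (N y))) differentiable (at x)"
  proof -
    obtain N' where "(N has_derivative N') (at x)" using Ndiff by (auto simp: differentiable_def)
    then have "((\<lambda>y. inverse (sqrt (N y))) has_derivative
        (\<lambda>u. - (inverse (sqrt (N x)) * (N' u * (inverse (sqrt (N x)) / 2)) * inverse (sqrt (N x))))) (at x)"
      using Npos by (auto intro!: derivative_eq_intros)
    then show ?thesis by (auto simp: differentiable_def)
  qed
  then have "(\<lambda>y. inverse (sqrt (N y)) *\<^sub>R w y) differentiable (at x)"
    using wdiff by (rule differentiable_scaleR)
  then have "\<forall>i<Suc k. e' i differentiable (at x)"
    using diff by (simp add: e'_def less_Suc_eq)
  moreover have "\<forall>\<^sub>F y in nhds x. \<forall>i<Suc k. \<forall>j<Suc k. g y (e' i y) (e' j y) = (if i = j then 1 else 0)"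
    using on wnz eventually_nhds_in_open[OF open_U x]
  proof eventually_elim
    case (elim y)
    interpret y: scalar_product "g y" by (rule scalar_product[OF elim(3)])
    have N: "N y > 0" unfolding N_def by (rule y.pos[OF elim(2)])
    have orth: "g y (w y) (e j y) = 0" if j: "j < k" for j
    proof -
      have "(\<Sum>i<k. g y v (e i y) * g y (e i y) (e j y)) = (\<Sum>i<k. g y v (e i y) * (if i = j then 1 else 0))"
        using elim(1) j by (intro sum.cong) auto
      also have "\<dots> = g y v (e j y)" using j by (simp add: if_distrib cong: if_cong)
      finally show ?thesis by (simp add: w_def y.bsimps y.sum_left)
    qed
    have "g y (e' k y) (e' k y) = 1"
      using N by (simp add: e'_def y.bsimps N_def[symmetric] field_simps)
    moreover have "g y (e' k y) (e' j y) = 0" "g y (e' j y) (e' k y) = 0" if "j < k" for j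
      using orth[OF that] that by (simp_all add: e'_def y.bsimps y.sym[of "e j y"])
    moreover have "g y (e' i y) (e' j y) = (if i = j then 1 else 0)" if "i < k" "j < k" for i j
      using elim(1) that by (simp add: e'_def)
    ultimately show ?case by (simp add: less_Suc_eq all_conj_distrib imp_conjR disj_imp) (metis less_irrefl)
  qed
  ultimately show ?case by blast
qed

lemma local_frame:
  assumes x: "x \<in> U"
  shows "\<exists>e W. (\<forall>i<DIM('a). e i differentiable (at x)) \<and> open W \<and> x \<in> W \<and> W \<subseteq> U \<and>
    (\<forall>y\<in>W. orthonormal_basis (g y) (\<lambda>i. e i y))"
proof -
  obtain e where e: "\<forall>i<DIM('a). e i differentiable (at x)"
    "\<forall>\<^sub>F y in nhds x. \<forall>i<DIM('a). \<forall>j<DIM('a). g y (e i y) (e j y) = (if i = j then 1 else 0)"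
    using local_frame_aux[OF x order_refl] by (elim exE conjE)
  from e(2) obtain W where W: "open W" "x \<in> W" "\<forall>y\<in>W. orthonormal_basis (g y) (\<lambda>i. e i y)"
    unfolding eventually_nhds orthonormal_basis_def by (elim exE conjE)
  show ?thesis
  proof (intro exI conjI)
    show "open (W \<inter> U)" using W(1) open_U by (rule open_Int)
    show "\<forall>y\<in>W \<inter> U. orthonormal_basis (g y) (\<lambda>i. e i y)" using W(3) by simp
  qed (use e(1) W(2) x in auto)
qed

lemma orthonormal_basis_exists:
  assumes "x \<in> U" shows "\<exists>e. orthonormal_basis (g x) e"
proof -
  obtain e W where "x \<in> W" "\<forall>y\<in>W. orthonormal_basis (g y) (\<lambda>i. e i y)"
    using local_frame[OF assms] by (elim exE conjE)
  then show ?thesis by (intro exI) (erule (1) bspec[rotated])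
qed

subsection \<open>The Levi-Civita connection\<close>

abbreviation koszul :: "'a \<Rightarrow> 'a \<Rightarrow> 'a \<Rightarrow> 'a \<Rightarrow> real" where
  "koszul y u v z \<equiv> dg y u v z + dg y v u z - dg y z u v"

lemma linear_koszul: "y \<in> U \<Longrightarrow> linear (koszul y u v)"
  by (intro linear_compose_sub linear_compose_add linear_dg_right linear_dg)

text \<open>Resolves the definite description: the Riesz vector of half the Koszul functional is a
  solution, and positivity of the metric makes it the only one.\<close>

lemma christoffel_expand:
  assumes y: "y \<in> U" and e: "orthonormal_basis (g y) e"
  shows "\<Gamma> y u v = (\<Sum>i<DIM('a). (koszul y u v (e i) / 2) *\<^sub>R e i)"
proof -
  interpret y: scalar_product "g y" by (rule scalar_product[OF y])
  let ?w = "\<Sum>i<DIM('a). koszul y u v (e i) *\<^sub>R e i"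
  have riesz: "g y ?w z = koszul y u v z" for z
    by (rule y.riesz[OF e linear_koszul[OF y]])
  have half: "(\<Sum>i<DIM('a). (koszul y u v (e i) / 2) *\<^sub>R e i) = (1/2) *\<^sub>R ?w"
    by (simp add: scaleR_sum_right)
  show ?thesis
    unfolding christoffel_def half
  proof (rule the_equality)
    show "\<forall>z. 2 * g y ((1/2) *\<^sub>R ?w) z = koszul y u v z"
      unfolding y.bsimps riesz by simp
    fix w assume w: "\<forall>z. 2 * g y w z = koszul y u v z"
    show "w = (1/2) *\<^sub>R ?w"
    proof (rule y.eqI)
      fix z
      have "2 * g y w z = koszul y u v z" using w by blast
      then show "g y w z = g y ((1/2) *\<^sub>R ?w) z" unfolding y.bsimps riesz by simp
    qed
  qed
qed

lemma christoffel:
  assumes y: "y \<in> U"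
  shows "2 * g y (\<Gamma> y u v) z = koszul y u v z"
proof -
  interpret y: scalar_product "g y" by (rule scalar_product[OF y])
  obtain e where e: "orthonormal_basis (g y) e" using orthonormal_basis_exists[OF y] by blast
  have "g y (\<Sum>i<DIM('a). koszul y u v (e i) *\<^sub>R e i) z = koszul y u v z"
    by (rule y.riesz[OF e linear_koszul[OF y]])
  then show ?thesis
    unfolding christoffel_expand[OF y e] y.sum_left
    by (simp add: sum_divide_distrib[symmetric] sum_distrib_left)
qed

lemma christoffel_sym:
  assumes "y \<in> U" shows "\<Gamma> y u v = \<Gamma> y v u"
proof (rule metric_eqI[OF assms])
  fix z
  have "2 * g y (\<Gamma> y u v) z = 2 * g y (\<Gamma> y v u) z"
    unfolding christoffel[OF assms] using dg_sym[OF assms, of u v z] by linarith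
  then show "g y (\<Gamma> y u v) z = g y (\<Gamma> y v u) z" by simp
qed

lemma linear_christoffel_right:
  assumes y: "y \<in> U" shows "linear (\<Gamma> y u)"
proof -
  have *: "g y (\<Gamma> y u v) z = koszul y u v z / 2" for v z
    using christoffel[OF y, of u v z] by simp
  note lins = linear_add[OF linear_dg_middle[OF y]] linear_add[OF linear_dg_right[OF y]]
    linear_add[OF linear_dg[OF y]] linear_cmul[OF linear_dg_middle[OF y]]
    linear_cmul[OF linear_dg_right[OF y]] linear_cmul[OF linear_dg[OF y]]
  show ?thesis
  proof (rule linearI)
    fix v1 v2 and c :: real
    show "\<Gamma> y u (v1 + v2) = \<Gamma> y u v1 + \<Gamma> y u v2"
      by (rule metric_eqI[OF y]) (simp add: bsimps[OF y] * lins field_simps)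
    show "\<Gamma> y u (c *\<^sub>R v1) = c *\<^sub>R \<Gamma> y u v1"
      by (rule metric_eqI[OF y]) (simp add: bsimps[OF y] * lins algebra_simps)
  qed
qed

text \<open>Add the Koszul formulas for \<open>(u, v, z)\<close> and \<open>(u, z, v)\<close>: the
  derivatives in the directions \<open>v\<close> and \<open>z\<close> cancel.\<close>

lemma metric_compatible:
  assumes y: "y \<in> U"
  shows "dg y u v z = g y (\<Gamma> y u v) z + g y v (\<Gamma> y u z)"
proof -
  have "2 * dg y u v z = 2 * g y (\<Gamma> y u v) z + 2 * g y (\<Gamma> y u z) v"
    unfolding christoffel[OF y] by (simp add: dg_sym[OF y, of _ z] dg_sym[OF y, of v u z])
  then show ?thesis by (simp add: sym[OF y, of v])
qed

text \<open>The description of \<open>christoffel\<close> is pointwise and says nothing about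
  varying the point; its expansion in a local frame does. As the frame vectors themselves move, the
  Koszul functional is evaluated on the constant Euclidean basis, where its values are
  smooth.\<close>

lemma differentiable_christoffel:
  assumes x: "x \<in> U" shows "(\<lambda>y. \<Gamma> y u v) differentiable (at x)"
proof -
  obtain e W where e: "\<forall>i<DIM('a). e i differentiable (at x)"
    and W: "open W" "x \<in> W" "W \<subseteq> U" "\<forall>y\<in>W. orthonormal_basis (g y) (\<lambda>i. e i y)"
    using local_frame[OF x] by (elim exE conjE)
  have k: "(\<lambda>y. koszul y u v z) differentiable (at x)" for z
    by (intro differentiable_diff differentiable_add smooth_on_differentiable[OF smooth_dg x])
  have "(\<lambda>y. \<Sum>i<DIM('a). ((\<Sum>b\<in>Basis. (e i y \<bullet> b) * koszul y u v b) / 2) *\<^sub>R e i y) differentiable (at x)"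
    unfolding divide_inverse
  proof (intro differentiable_sum ballI finite_lessThan finite_Basis)
    fix i assume "i \<in> {..<DIM('a)}"
    then have ei: "e i differentiable (at x)" using e by simp
    then have "(\<lambda>y. \<Sum>b\<in>Basis. (e i y \<bullet> b) * koszul y u v b) differentiable (at x)"
      by (intro differentiable_sum ballI finite_Basis differentiable_mult differentiable_inner
          differentiable_const k)
    then show "(\<lambda>y. ((\<Sum>b\<in>Basis. (e i y \<bullet> b) * koszul y u v b) * inverse 2) *\<^sub>R e i y)
        differentiable (at x)"
      by (intro differentiable_scaleR differentiable_mult differentiable_const ei)
  qed
  then show ?thesis
  proof (rule differentiable_transform_open[OF _ W(1,2)])
    fix y assume y: "y \<in> W"
    then have yU: "y \<in> U" using W(3) by blast
    have expand: "koszul y u v z = (\<Sum>b\<in>Basis. (z \<bullet> b) * koszul y u v b)" for z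
    proof -
      have "koszul y u v z = koszul y u v (\<Sum>b\<in>Basis. (z \<bullet> b) *\<^sub>R b)"
        by (simp add: euclidean_representation)
      also have "\<dots> = (\<Sum>b\<in>Basis. (z \<bullet> b) * koszul y u v b)"
        unfolding linear_sum[OF linear_koszul[OF yU]] linear_cmul[OF linear_koszul[OF yU]] by simp
      finally show ?thesis .
    qed
    show "(\<Sum>i<DIM('a). ((\<Sum>b\<in>Basis. (e i y \<bullet> b) * koszul y u v b) / 2) *\<^sub>R e i y) = \<Gamma> y u v"
      unfolding christoffel_expand[OF yU bspec[OF W(4) y]] by (simp only: expand[of "e _ y"])
  qed
qed

subsection \<open>Symmetries of the curvature\<close>

lemma curvature_eq:
  "curvature g x u v w = (D (\<lambda>y. \<Gamma> y v w) x u + \<Gamma> x u (\<Gamma> x v w))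
    - (D (\<lambda>y. \<Gamma> y u w) x v + \<Gamma> x v (\<Gamma> x u w))"
  by (simp add: curvature_def cov_deriv_def)

lemma D_christoffel_sym:
  assumes x: "x \<in> U" shows "D (\<lambda>y. \<Gamma> y u v) x = D (\<lambda>y. \<Gamma> y v u) x"
  by (rule frechet_derivative_transform_within_open[OF differentiable_christoffel[OF x] open_U x])
     (rule christoffel_sym)

text \<open>A consequence of vanishing torsion: once the two arguments of every
  \<open>\<Gamma>\<close> may be exchanged, the cyclic sum cancels in pairs.\<close>

lemma bianchi:
  assumes x: "x \<in> U"
  shows "curvature g x u v w + curvature g x v w u + curvature g x w u v = 0"
  unfolding curvature_eq
  by (simp add: D_christoffel_sym[OF x, of w u] D_christoffel_sym[OF x, of w v]
      D_christoffel_sym[OF x, of v u] christoffel_sym[OF x, of w u] christoffel_sym[OF x, of w v]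
      christoffel_sym[OF x, of v u])

lemma curvature_swap: "curvature g x u v w = - curvature g x v u w"
  by (simp add: curvature_eq)

text \<open>Differentiates \<open>metric_compatible\<close> once more. The terms are grouped so that
  exchanging \<open>u\<close> and \<open>v\<close> swaps the two middle ones, while antisymmetrizing
  the outer ones produces the curvature.\<close>

lemma second_derivative_metric:
  assumes x: "x \<in> U"
  shows "D (\<lambda>y. dg y v w z) x u =
    g x (D (\<lambda>y. \<Gamma> y v w) x u + \<Gamma> x u (\<Gamma> x v w)) z + g x (\<Gamma> x v w) (\<Gamma> x u z)
    + g x (\<Gamma> x u w) (\<Gamma> x v z) + g x w (D (\<lambda>y. \<Gamma> y v z) x u + \<Gamma> x u (\<Gamma> x v z))"
proof -
  have \<Gamma>: "((\<lambda>y. \<Gamma> y v w) has_derivative D (\<lambda>y. \<Gamma> y v w) x) (at x)" for v w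
    using differentiable_christoffel[OF x] by (simp add: frechet_derivative_works)
  have "((\<lambda>y. g y (\<Gamma> y v w) z + g y w (\<Gamma> y v z)) has_derivative
     (\<lambda>u. (dg x u (\<Gamma> x v w) z + g x (D (\<lambda>y. \<Gamma> y v w) x u) z + g x (\<Gamma> x v w) 0)
       + (dg x u w (\<Gamma> x v z) + g x 0 (\<Gamma> x v z) + g x w (D (\<lambda>y. \<Gamma> y v z) x u)))) (at x)"
    by (intro has_derivative_add has_derivative_metric[OF x] \<Gamma> has_derivative_const)
  then have "((\<lambda>y. dg y v w z) has_derivative
     (\<lambda>u. (dg x u (\<Gamma> x v w) z + g x (D (\<lambda>y. \<Gamma> y v w) x u) z + g x (\<Gamma> x v w) 0)
       + (dg x u w (\<Gamma> x v z) + g x 0 (\<Gamma> x v z) + g x w (D (\<lambda>y. \<Gamma> y v z) x u)))) (at x)"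
    by (rule has_derivative_transform_within_open[OF _ open_U x]) (simp add: metric_compatible)
  then show ?thesis
    by (simp add: frechet_derivative_eqI metric_compatible[OF x] bsimps[OF x])
qed

text \<open>Second derivatives of the metric coefficients commute, so antisymmetrizing
  \<open>second_derivative_metric\<close> in \<open>u\<close> and \<open>v\<close> gives zero on one
  side and the two curvature terms on the other.\<close>

lemma curvature_skew:
  assumes x: "x \<in> U"
  shows "g x (curvature g x u v w) z = - g x (curvature g x u v z) w"
proof -
  have "D (\<lambda>y. dg y v w z) x u = D (\<lambda>y. dg y u w z) x v"
    by (rule second_derivative_symmetric[OF open_U x smooth])
  then show ?thesis
    unfolding second_derivative_metric[OF x] curvature_eq sym[OF x, of _ w]
    by (simp add: bsimps[OF x] sym[OF x, of "\<Gamma> x v w"] algebra_simps)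
qed

text \<open>Pure algebra: a linear combination of four cyclic identities and the skew symmetries
  within both pairs.\<close>

lemma curvature_pair_sym:
  assumes x: "x \<in> U"
  shows "g x (curvature g x u v w) z = g x (curvature g x w z u) v"
proof -
  let ?R = "\<lambda>u v w z. g x (curvature g x u v w) z"
  have b: "?R u v w z + ?R v w u z + ?R w u v z = 0" for u v w z
    using arg_cong[OF bianchi[OF x, of u v w], of "\<lambda>r. g x r z"] by (simp add: bsimps[OF x])
  have s: "?R u v w z = - ?R v u w z" for u v w z
    by (subst curvature_swap) (simp add: bsimps[OF x])
  note k = curvature_skew[OF x]
  show ?thesis
    using b[of u v w z] b[of v w z u] b[of w z u v] b[of z u v w]
      k[of v w u z] k[of w z v u] s[of u w z v] k[of w u z v]
      k[of z u v w] k[of u v z w] s[of v z u w] k[of z v u w]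
    by linarith
qed

lemma linear_curvature:
  assumes x: "x \<in> U" shows "linear (curvature g x u v)"
proof -
  have D_add: "D (\<lambda>y. \<Gamma> y v (w1 + w2)) x u = D (\<lambda>y. \<Gamma> y v w1) x u + D (\<lambda>y. \<Gamma> y v w2) x u"
    for u v w1 w2
  proof -
    have "((\<lambda>y. \<Gamma> y v w1 + \<Gamma> y v w2) has_derivative
        (\<lambda>u. D (\<lambda>y. \<Gamma> y v w1) x u + D (\<lambda>y. \<Gamma> y v w2) x u)) (at x)"
      using differentiable_christoffel[OF x]
      by (intro has_derivative_add) (simp_all add: frechet_derivative_works)
    then have "((\<lambda>y. \<Gamma> y v (w1 + w2)) has_derivative
        (\<lambda>u. D (\<lambda>y. \<Gamma> y v w1) x u + D (\<lambda>y. \<Gamma> y v w2) x u)) (at x)"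
      by (rule has_derivative_transform_within_open[OF _ open_U x])
         (simp add: linear_add[OF linear_christoffel_right])
    then show ?thesis by (simp add: frechet_derivative_eqI)
  qed
  have D_scale: "D (\<lambda>y. \<Gamma> y v (c *\<^sub>R w)) x u = c *\<^sub>R D (\<lambda>y. \<Gamma> y v w) x u" for u v w c
  proof -
    have "((\<lambda>y. c *\<^sub>R \<Gamma> y v w) has_derivative (\<lambda>u. c *\<^sub>R D (\<lambda>y. \<Gamma> y v w) x u)) (at x)"
      using differentiable_christoffel[OF x]
      by (intro has_derivative_scaleR_right) (simp_all add: frechet_derivative_works)
    then have "((\<lambda>y. \<Gamma> y v (c *\<^sub>R w)) has_derivative (\<lambda>u. c *\<^sub>R D (\<lambda>y. \<Gamma> y v w) x u)) (at x)"
      by (rule has_derivative_transform_within_open[OF _ open_U x])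
         (simp add: linear_cmul[OF linear_christoffel_right])
    then show ?thesis by (simp add: frechet_derivative_eqI)
  qed
  note lin = linear_add[OF linear_christoffel_right[OF x]] linear_cmul[OF linear_christoffel_right[OF x]]
  show ?thesis
    by (rule linearI) (simp_all add: curvature_eq D_add D_scale lin algebra_simps)
qed

text \<open>Linearity is established in the last two arguments and carried over to the first two by
  the pair symmetry.\<close>

lemma curvature_dform_multilinear:
  assumes x: "x \<in> U" shows "multilinear_dform 2 2 (curvature_dform g x)"
proof -
  interpret x: scalar_product "g x" by (rule scalar_product[OF x])
  have lin3: "linear (\<lambda>w. g x (curvature g x u v w) z)" for u v z
    using linear_compose[OF linear_curvature[OF x] x.linear_left] by (simp add: comp_def)
  have lin4: "linear (\<lambda>z. g x (curvature g x u v w) z)" for u v w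
    by (rule x.linear_right)
  have lin1: "linear (\<lambda>u. g x (curvature g x u v w) z)" for v w z
    using lin3[of w z v] unfolding curvature_pair_sym[OF x, of w] .
  have lin2: "linear (\<lambda>v. g x (curvature g x u v w) z)" for u w z
    using lin4[of w z u] unfolding curvature_pair_sym[OF x, of w] .
  show ?thesis
    unfolding multilinear_dform_def multilinear_form_def curvature_dform_def
    by (auto simp: less_2_cases_iff lin1 lin2 lin3 lin4)
qed

end

section \<open>Isometric immersions of open sets\<close>

locale isometric_chart_map = sub: chart_metric S g + ambient: chart_metric T h
  for S :: "'a::euclidean_space set" and g and T :: "'b::euclidean_space set" and h +
  fixes F :: "'a \<Rightarrow> 'b"
  assumes F_smooth: "smooth_on S F" and F_into: "y \<in> S \<Longrightarrow> F y \<in> T"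
    and induced: "y \<in> S \<Longrightarrow> g y u v = h (F y) (D F y u) (D F y v)"
begin

text \<open>The pullback connection applied to the field \<open>D F y v\<close>, before any
  projection. Its tangential part is the Levi-Civita connection of \<open>g\<close>, its normal part
  the second fundamental form.\<close>

definition ambient_deriv :: "'a \<Rightarrow> 'a \<Rightarrow> 'a \<Rightarrow> 'b" where
  "ambient_deriv x u v = D (\<lambda>y. D F y v) x u + christoffel h (F x) (D F x u) (D F x v)"

lemma has_derivative_F: "x \<in> S \<Longrightarrow> (F has_derivative D F x) (at x)"
  using smooth_on_differentiable[OF F_smooth] by (simp add: frechet_derivative_works)

lemma differentiable_DF: "x \<in> S \<Longrightarrow> (\<lambda>y. D F y v) differentiable (at x)"
  by (rule smooth_on_differentiable[OF smooth_on_directional[OF F_smooth]])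

lemma has_derivative_DF: "x \<in> S \<Longrightarrow> ((\<lambda>y. D F y v) has_derivative D (\<lambda>y. D F y v) x) (at x)"
  using differentiable_DF by (simp add: frechet_derivative_works)

lemma linear_DF: "x \<in> S \<Longrightarrow> linear (D F x)"
  using has_derivative_F by (rule has_derivative_linear)

text \<open>Second derivatives of \<open>F\<close> commute and the ambient connection has no
  torsion; this is the source of the symmetry of the second fundamental form.\<close>

lemma ambient_deriv_sym:
  assumes x: "x \<in> S" shows "ambient_deriv x u v = ambient_deriv x v u"
  unfolding ambient_deriv_def
  using second_derivative_symmetric[OF sub.open_U x F_smooth, of v u]
    ambient.christoffel_sym[OF F_into[OF x], of "D F x u"] by simp

lemma linear_ambient_deriv_left:
  assumes x: "x \<in> S" shows "linear (\<lambda>u. ambient_deriv x u v)"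
proof -
  have "linear (\<lambda>u. christoffel h (F x) (D F x v) (D F x u))"
    using linear_compose[OF linear_DF[OF x] ambient.linear_christoffel_right[OF F_into[OF x]]]
    by (simp add: comp_def)
  then show ?thesis
    unfolding ambient_deriv_def ambient.christoffel_sym[OF F_into[OF x], of _ "D F x v"]
    by (intro linear_compose_add has_derivative_linear[OF has_derivative_DF[OF x]])
qed

lemma linear_ambient_deriv_right:
  assumes x: "x \<in> S" shows "linear (ambient_deriv x u)"
proof -
  have "ambient_deriv x u = (\<lambda>v. ambient_deriv x v u)" by (intro ext ambient_deriv_sym x)
  then show ?thesis using linear_ambient_deriv_left[OF x] by (simp only:)
qed

text \<open>Metric compatibility of the pullback connection. The derivative of \<open>h\<close> at
  the moving base point supplies exactly the Christoffel terms that complete the derivatives of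
  \<open>D F\<close> to \<open>ambient_deriv\<close>.\<close>

lemma dg_induced:
  assumes x: "x \<in> S"
  shows "sub.dg x u v z =
    h (F x) (ambient_deriv x u v) (D F x z) + h (F x) (D F x v) (ambient_deriv x u z)"
proof -
  note Fx = F_into[OF x]
  have "((\<lambda>y. h (F y) (D F y v) (D F y z)) has_derivative
      (\<lambda>u. ambient.dg (F x) (D F x u) (D F x v) (D F x z)
        + h (F x) (D (\<lambda>y. D F y v) x u) (D F x z) + h (F x) (D F x v) (D (\<lambda>y. D F y z) x u))) (at x)"
  proof (rule has_derivative_bilinear_family[OF sub.open_U x _ _ has_derivative_DF[OF x] has_derivative_DF[OF x]])
    show "bilinear (h (F y))" if "y \<in> S" for y by (rule ambient.bil[OF F_into[OF that]])
    show "((\<lambda>y. h (F y) u v) has_derivative (\<lambda>w. ambient.dg (F x) (D F x w) u v)) (at x)" for u v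
      using diff_chain_at[OF has_derivative_F[OF x] ambient.has_derivative_dg[OF Fx]]
      by (simp add: comp_def)
  qed
  then have "((\<lambda>y. g y v z) has_derivative
      (\<lambda>u. ambient.dg (F x) (D F x u) (D F x v) (D F x z)
        + h (F x) (D (\<lambda>y. D F y v) x u) (D F x z) + h (F x) (D F x v) (D (\<lambda>y. D F y z) x u))) (at x)"
    by (rule has_derivative_transform_within_open[OF _ sub.open_U x]) (simp add: induced)
  from frechet_derivative_eqI[OF this] show ?thesis
    by (simp add: ambient.metric_compatible[OF Fx] ambient_deriv_def ambient.bsimps[OF Fx])
qed

text \<open>When \<open>dg_induced\<close> is inserted into the Koszul formula, symmetry of
  \<open>ambient_deriv\<close> cancels everything but twice the term on the right.\<close>

lemma gauss_formula:
  assumes x: "x \<in> S"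
  shows "g x (christoffel g x u v) z = h (F x) (ambient_deriv x u v) (D F x z)"
proof -
  have "2 * g x (christoffel g x u v) z = 2 * h (F x) (ambient_deriv x u v) (D F x z)"
    unfolding sub.christoffel[OF x] dg_induced[OF x]
    using ambient_deriv_sym[OF x, of v u] ambient_deriv_sym[OF x, of z u]
      ambient_deriv_sym[OF x, of z v]
      ambient.sym[OF F_into[OF x], of "D F x v"] ambient.sym[OF F_into[OF x], of "D F x u"]
    by simp
  then show ?thesis by simp
qed

text \<open>Shows that the description defines an orthogonal projection. A difference of two
  candidates is both tangent and normal, so positivity of \<open>h\<close> makes it zero.\<close>

lemma normal_part:
  assumes x: "x \<in> S"
  shows "normal_vector h F x (normal_part h F x w) \<and> w - normal_part h F x w \<in> range (D F x)"
  unfolding normal_part_def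
proof (rule theI')
  interpret x: scalar_product "g x" by (rule sub.scalar_product[OF x])
  interpret Fx: scalar_product "h (F x)" by (rule ambient.scalar_product[OF F_into[OF x]])
  obtain e where e: "orthonormal_basis (g x) e" using sub.orthonormal_basis_exists[OF x] by blast
  define l where "l u = h (F x) (D F x u) w" for u
  have l: "linear l"
    using linear_compose[OF linear_DF[OF x] Fx.linear_left[of w]] by (simp add: comp_def l_def[abs_def])
  \<comment> \<open>The Riesz vector of pairing with \<open>w\<close>, taken with respect to
    \<open>g\<close>; its image under \<open>D F x\<close> is the tangential component of
    \<open>w\<close>.\<close>
  define t where "t = (\<Sum>i<DIM('a). l (e i) *\<^sub>R e i)"
  have t: "g x t u = l u" for u unfolding t_def by (rule x.riesz[OF e l])
  have "h (F x) (D F x u) (w - D F x t) = 0" for u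
    using t[of u] by (simp add: Fx.bsimps l_def induced[OF x] Fx.sym[of "D F x t"])
  then have "normal_vector h F x (w - D F x t) \<and> w - (w - D F x t) \<in> range (D F x)"
    by (simp add: normal_vector_def)
  moreover have "N = N'" if N: "normal_vector h F x N" "w - N \<in> range (D F x)"
    and N': "normal_vector h F x N'" "w - N' \<in> range (D F x)" for N N'
  proof -
    obtain a b where ab: "w - N = D F x a" "w - N' = D F x b" using N(2) N'(2) by blast
    have eq: "N - N' = D F x (b - a)"
      unfolding linear_diff[OF linear_DF[OF x]] ab[symmetric] by simp
    have "h (F x) (D F x (b - a)) (N - N') = 0"
      using N(1) N'(1) by (simp add: normal_vector_def Fx.bsimps)
    then show ?thesis using Fx.pos[of "N - N'"] unfolding eq[symmetric] by force
  qed
  ultimately show "\<exists>!N. normal_vector h F x N \<and> w - N \<in> range (D F x)" by blast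
qed

text \<open>The discarded component is tangent and pairs to zero with \<open>N\<close>. This frees
  \<open>B_N\<close> from the projection, so bilinearity and behaviour under \<open>J\<close> can be
  read off from \<open>ambient_deriv\<close>.\<close>

lemma second_fundamental_form_normal:
  assumes x: "x \<in> S" and N: "normal_vector h F x N"
  shows "h (F x) (second_fundamental_form h F x u v) N = h (F x) (ambient_deriv x u v) N"
proof -
  interpret Fx: scalar_product "h (F x)" by (rule ambient.scalar_product[OF F_into[OF x]])
  obtain a where a: "ambient_deriv x u v - normal_part h F x (ambient_deriv x u v) = D F x a"
    using normal_part[OF x] by blast
  have "h (F x) (ambient_deriv x u v - normal_part h F x (ambient_deriv x u v)) N = 0"
    unfolding a using N by (simp add: normal_vector_def)
  then show ?thesis
    by (simp add: second_fundamental_form_def ambient_deriv_def[symmetric] Fx.bsimps)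
qed

end

section \<open>Kaehler metrics and holomorphic immersions\<close>

lemma linear_J: "linear J"
  by (rule linearI) (simp_all add: J_def vec_eq_iff algebra_simps)

lemma bounded_linear_J: "bounded_linear J"
  using linear_J by (simp add: linear_conv_bounded_linear)

lemma J_J [simp]: "J (J v) = - v"
  by (simp add: J_def vec_eq_iff mult.assoc[symmetric])

section \<open>Kaehler metrics in a chart\<close>

locale kaehler_chart = chart_metric T h for T :: "(complex ^ 'm) set" and h +
  assumes hermitian: "y \<in> T \<Longrightarrow> h y (J u) (J v) = h y u v"
    and closed: "y \<in> T \<Longrightarrow> ext_deriv2 (\<lambda>y u v. h y (J u) v) y u v w = 0"
begin

lemma J_skew: "y \<in> T \<Longrightarrow> h y (J u) v = - h y u (J v)"
  using hermitian[of y "J u" v] by (simp add: bsimps)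

text \<open>\<open>J\<close> is constant in coordinates, so the skewness \<open>J_skew\<close> may
  be differentiated in the base point.\<close>

lemma dg_J:
  assumes y: "y \<in> T" shows "dg y w (J u) v = - dg y w u (J v)"
proof -
  have "((\<lambda>y. h y (J u) v) has_derivative (\<lambda>w. - dg y w u (J v))) (at y)"
    by (rule has_derivative_transform_within_open[OF
          has_derivative_minus[OF has_derivative_dg[OF y]] open_U y]) (simp add: J_skew)
  from frechet_derivative_eqI[OF this] show ?thesis by simp
qed

text \<open>\<open>\<nabla>J = 0\<close>: the Koszul formulas of the two sides differ by
  \<open>d\<omega>(u, v, z) - d\<omega>(u, J v, J z)\<close>.\<close>

lemma christoffel_J:
  assumes y: "y \<in> T" shows "\<Gamma> y u (J v) = J (\<Gamma> y u v)"
proof (rule metric_eqI[OF y])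
  fix z
  have dneg: "dg y w (- a) b = - dg y w a b" "dg y w a (- b) = - dg y w a b"
    "dg y (- w) a b = - dg y w a b" for w a b
    using linear_neg[OF linear_dg_middle[OF y]] linear_neg[OF linear_dg_right[OF y]]
      linear_neg[OF linear_dg[OF y]] by blast+
  have "dg y u (J v) z + dg y v (J z) u + dg y z (J u) v = 0"
    using closed[OF y, of u v z] by (simp add: ext_deriv2_def)
  moreover have "dg y u (J (J v)) (J z) + dg y (J v) (J (J z)) u + dg y (J z) (J u) (J v) = 0"
    using closed[OF y, of u "J v" "J z"] by (simp add: ext_deriv2_def)
  \<comment> \<open>In the sum of the two Koszul expressions the derivatives in direction
    \<open>u\<close> cancel by \<open>dg_J\<close>, and the others by the two closedness relations.
    The minus sign is the one from moving \<open>J\<close> across \<open>h\<close>.\<close>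
  ultimately have "koszul y u (J v) z = - koszul y u v (J z)"
    using dg_J[OF y, where w = u and u = v and v = z]
      dg_J[OF y, where w = z and u = u and v = v]
      dg_J[OF y, where w = "J z" and u = u and v = "J v"]
      dg_sym[OF y, where u = v and v = "J z" and z = u]
      dg_sym[OF y, where u = "J v" and v = z and z = u]
    by (simp add: dneg)
  then have "2 * h y (\<Gamma> y u (J v)) z = - (2 * h y (\<Gamma> y u v) (J z))"
    unfolding christoffel[OF y] .
  then show "h y (\<Gamma> y u (J v)) z = h y (J (\<Gamma> y u v)) z"
    by (simp add: J_skew[OF y])
qed

end

section \<open>Holomorphic isometric immersions in charts\<close>

locale holomorphic_chart_map = isometric_chart_map S g T h F + kaehler: kaehler_chart T h
  for S :: "(complex ^ 'n) set" and g and T :: "(complex ^ 'm) set" and h F +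
  assumes DF_J: "y \<in> S \<Longrightarrow> D F y (J v) = J (D F y v)"
begin

lemma g_hermitian: "y \<in> S \<Longrightarrow> g y (J u) (J v) = g y u v"
  by (simp add: induced DF_J kaehler.hermitian[OF F_into])

lemma g_J_skew: "y \<in> S \<Longrightarrow> g y (J u) v = - g y u (J v)"
  using g_hermitian[of y "J u" v] by (simp add: sub.bsimps)

text \<open>\<open>J\<close> passes the differential of \<open>F\<close> by holomorphy, the
  derivative because it is constant, and the ambient Christoffel term by the Kaehler
  condition.\<close>

lemma ambient_deriv_J_right:
  assumes x: "x \<in> S" shows "ambient_deriv x u (J v) = J (ambient_deriv x u v)"
proof -
  have "D (\<lambda>y. D F y (J v)) x u = D (\<lambda>y. J (D F y v)) x u"
    by (rule fun_cong[OF frechet_derivative_transform_within_open[OF differentiable_DF[OF x]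
          sub.open_U x]]) (rule DF_J)
  also have "\<dots> = J (D (\<lambda>y. D F y v) x u)"
    by (rule frechet_derivative_bounded_linear[OF bounded_linear_J differentiable_DF[OF x]])
  finally show ?thesis
    by (simp add: ambient_deriv_def DF_J[OF x] kaehler.christoffel_J[OF F_into[OF x]]
        linear_add[OF linear_J])
qed

text \<open>Symmetry lets \<open>J\<close> leave the left slot as well, and the two copies combine
  to the square of \<open>J\<close>.\<close>

lemma ambient_deriv_J_J:
  assumes x: "x \<in> S" shows "ambient_deriv x (J u) (J v) = - ambient_deriv x u v"
  using ambient_deriv_J_right[OF x, of "J u" v] ambient_deriv_J_right[OF x, of v u]
  by (simp add: ambient_deriv_sym[OF x, of "J u" v] ambient_deriv_sym[OF x, of v u])

text \<open>Tested against tangent vectors, the induced connection is the ambient derivative by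
  \<open>gauss_formula\<close>, so the property descends from the ambient manifold.\<close>

lemma christoffel_J:
  assumes x: "x \<in> S" shows "christoffel g x u (J v) = J (christoffel g x u v)"
proof (rule sub.metric_eqI[OF x])
  fix z
  show "g x (christoffel g x u (J v)) z = g x (J (christoffel g x u v)) z"
    unfolding g_J_skew[OF x] gauss_formula[OF x] ambient_deriv_J_right[OF x] DF_J[OF x]
    by (rule kaehler.J_skew[OF F_into[OF x]])
qed

lemma curvature_J:
  assumes x: "x \<in> S" shows "curvature g x u v (J w) = J (curvature g x u v w)"
proof -
  have "D (\<lambda>y. christoffel g y v (J w)) x u = J (D (\<lambda>y. christoffel g y v w) x u)" for u v
  proof -
    have "D (\<lambda>y. christoffel g y v (J w)) x u = D (\<lambda>y. J (christoffel g y v w)) x u"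
      by (rule fun_cong[OF frechet_derivative_transform_within_open[OF
            sub.differentiable_christoffel[OF x] sub.open_U x]]) (rule christoffel_J)
    also have "\<dots> = J (D (\<lambda>y. christoffel g y v w) x u)"
      by (rule frechet_derivative_bounded_linear[OF bounded_linear_J sub.differentiable_christoffel[OF x]])
    finally show ?thesis .
  qed
  then show ?thesis
    by (simp add: sub.curvature_eq christoffel_J[OF x] linear_add[OF linear_J] linear_diff[OF linear_J])
qed

text \<open>In the last pair, \<open>J\<close> commutes with the curvature operator and is an
  isometry; the pair symmetry moves the first pair into that position.\<close>

lemma curvature_dform_J:
  assumes x: "x \<in> S"
  shows "curvature_dform g x (J \<circ> u) (J \<circ> w) = curvature_dform g x u w"
proof -
  have inv: "g x (curvature g x a b (J c)) (J d) = g x (curvature g x a b c) d" for a b c d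
    by (simp add: curvature_J[OF x] g_hermitian[OF x])
  have "g x (curvature g x (J a) (J b) c) d = g x (curvature g x a b c) d" for a b c d
    unfolding sub.curvature_pair_sym[OF x, where w = c] by (rule inv)
  then show ?thesis by (simp add: curvature_dform_def inv)
qed

lemma gauss_bonnet_odd_zero:
  assumes x: "x \<in> S" and N: "normal_vector h F x N"
  shows "gauss_bonnet_odd k (g x) (curvature_dform g x)
    (\<lambda>u v. h (F x) (second_fundamental_form h F x u v) N) = 0"
proof (rule gauss_bonnet_odd_eq_0[where T = J])
  interpret x: scalar_product "g x" by (rule sub.scalar_product[OF x])
  interpret Fx: scalar_product "h (F x)" by (rule ambient.scalar_product[OF F_into[OF x]])
  show "bilinear (g x)" by (rule x.bilinear)
  show "multilinear_dform 2 2 (curvature_dform g x)" by (rule sub.curvature_dform_multilinear[OF x])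
  show "bilinear (\<lambda>u v. h (F x) (second_fundamental_form h F x u v) N)"
    unfolding second_fundamental_form_normal[OF x N] bilinear_def
    using linear_compose[OF linear_ambient_deriv_left[OF x] Fx.linear_left[of N]]
      linear_compose[OF linear_ambient_deriv_right[OF x] Fx.linear_left[of N]]
    by (simp add: comp_def)
  show "\<exists>e. orthonormal_basis (g x) e" by (rule sub.orthonormal_basis_exists[OF x])
  show "v = (\<Sum>i<DIM(complex ^ 'n). g x v (e i) *\<^sub>R e i)" if "orthonormal_basis (g x) e" for e v
    by (rule x.orthonormal_basis_expand[OF that])
  show "g x (J u) (J v) = g x u v" for u v by (rule g_hermitian[OF x])
  show "curvature_dform g x (J \<circ> u) (J \<circ> w) = curvature_dform g x u w" for u w
    by (rule curvature_dform_J[OF x])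
  show "h (F x) (second_fundamental_form h F x (J u) (J v)) N =
      - h (F x) (second_fundamental_form h F x u v) N" for u v
    unfolding second_fundamental_form_normal[OF x N] ambient_deriv_J_J[OF x] by (simp add: Fx.bsimps)
qed

end

section \<open>Complex submanifolds of Kaehler manifolds\<close>

lemma Ck_on_subset: "Ck_on k S F \<Longrightarrow> T \<subseteq> S \<Longrightarrow> Ck_on k T F"
  by (induction k arbitrary: F) (auto intro: continuous_on_subset)

lemma smooth_on_subset: "smooth_on S F \<Longrightarrow> T \<subseteq> S \<Longrightarrow> smooth_on T F"
  unfolding smooth_on_def using Ck_on_subset by blast

lemma (in riemannian_manifold) chart_metric:
  assumes c: "c \<in> A" and S: "open S" "S \<subseteq> snd c ` fst c"
  shows "chart_metric S (g c)"
proof (rule chart_metric.intro)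
  fix y assume "y \<in> S"
  then have y: "y \<in> snd c ` fst c" using S by blast
  show "scalar_product (g c y)"
  proof
    show "g c y u v = g c y v u" for u v by (rule metric_sym[OF c y])
  qed (use metric_bilinear[OF c y] metric_pos[OF c y] in auto)
next
  show "smooth_on S (\<lambda>y. g c y u v)" for u v
    by (rule smooth_on_subset[OF metric_smooth[OF c] S(2)])
qed (rule S(1))

text \<open>Continuity of \<open>f\<close> makes the preimage of a chart domain open, and the chart
  is an open map onto an open image. Openness is what the calculus on chart domains rests
  on.\<close>

lemma (in isometric_immersion) open_local_dom:
  assumes c: "c \<in> A" and d: "d \<in> B"
  shows "open (local_dom c d f)"
proof -
  have sub: "fst c \<subseteq> topspace X" using sub.chart_dom[OF c] by (rule openin_subset)
  have "openin X {p \<in> topspace X. f p \<in> fst d}"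
    by (rule openin_continuous_map_preimage[OF map_continuous ambient.chart_dom[OF d]])
  then have "openin (subtopology X (fst c)) ({p \<in> topspace X. f p \<in> fst d} \<inter> fst c)"
    by (rule openin_subtopology_Int)
  moreover have "{p \<in> topspace X. f p \<in> fst d} \<inter> fst c = fst c \<inter> f -` fst d" using sub by blast
  moreover have "open_map (subtopology X (fst c)) (top_of_set (snd c ` fst c)) (snd c)"
    by (rule homeomorphic_imp_open_map[OF sub.chart_homeo[OF c]])
  ultimately have "openin (top_of_set (snd c ` fst c)) (local_dom c d f)"
    unfolding local_dom_def open_map_def by simp
  then show ?thesis using sub.chart_range[OF c] openin_open_trans by blast
qed

text \<open>Injectivity of the chart is the point: it makes \<open>inv_into\<close> recover the
  point from its coordinates.\<close>

lemma (in isometric_immersion) local_rep_into: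
  assumes c: "c \<in> A" and y: "y \<in> local_dom c d f"
  shows "local_rep c d f y \<in> snd d ` fst d"
proof -
  have "inj_on (snd c) (topspace (subtopology X (fst c)))"
    by (rule homeomorphic_imp_injective_map[OF sub.chart_homeo[OF c]])
  then have "inj_on (snd c) (fst c)"
    using openin_subset[OF sub.chart_dom[OF c]] by (simp add: Int_absorb1)
  then show ?thesis using y by (auto simp: local_dom_def local_rep_def)
qed

theorem mainTheorem2:
  fixes X :: "'p topology" and A :: "('p, complex ^ 'n) chart set"
    and g :: "('p, complex ^ 'n) chart \<Rightarrow> complex ^ 'n \<Rightarrow> complex ^ 'n \<Rightarrow> complex ^ 'n \<Rightarrow> real"
    and Y :: "'q topology" and B :: "('q, complex ^ 'm) chart set"
    and h :: "('q, complex ^ 'm) chart \<Rightarrow> complex ^ 'm \<Rightarrow> complex ^ 'm \<Rightarrow> complex ^ 'm \<Rightarrow> real"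
    and f :: "'p \<Rightarrow> 'q" and k :: nat
  assumes "kaehler_manifold Y B h"
    and "complex_submanifold X A g Y B h f"
    and "2 * k \<le> DIM(complex ^ 'n)"
  shows "isometric_immersion.minimal_2k A g B h f k"
proof -
  interpret K: kaehler_manifold Y B h by (rule assms(1))
  interpret M: complex_submanifold X A g Y B h f by (rule assms(2))
  show ?thesis
    unfolding M.minimal_2k_def
  proof (intro ballI allI impI)
    fix c d x N
    assume c: "c \<in> A" and d: "d \<in> B" and x: "x \<in> local_dom c d f"
      and N: "normal_vector (h d) (local_rep c d f) x N"
    let ?S = "local_dom c d f" and ?T = "snd d ` fst d" and ?F = "local_rep c d f"
    have "chart_metric ?S (g c)"
      using M.sub.chart_metric[OF c M.open_local_dom[OF c d]] by (auto simp: local_dom_def)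
    moreover have "chart_metric ?T (h d)"
      using K.chart_metric[OF d K.chart_range[OF d]] by simp
    \<comment> \<open>All ingredients of \<open>minimal_2k\<close> live in one pair of charts, so
      the claim reduces to the local one for the coordinate expression of \<open>f\<close>, with the
      whole image of the chart \<open>d\<close> as target.\<close>
    ultimately interpret holomorphic_chart_map ?S "g c" ?T "h d" ?F
      using M.map_smooth[OF c d] M.local_rep_into[OF c, of _ d] M.induced_metric[OF c d _ refl]
        K.hermitian[OF d] K.kaehler_form_closed[OF d] M.map_holomorphic[OF c d]
      by (auto simp: holomorphic_chart_map_def holomorphic_chart_map_axioms_def
          isometric_chart_map_def isometric_chart_map_axioms_def kaehler_chart_def
          kaehler_chart_axioms_def holomorphic_map_on_def)
    show "gauss_bonnet_odd k (g c x) (curvature_dform (g c) x)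
        (\<lambda>u v. h d (?F x) (second_fundamental_form (h d) ?F x u v) N) = 0"
      by (rule gauss_bonnet_odd_zero[OF x N])
  qed
qed

end
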